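(* In the setting fixed in the context (regularized 2-1 junction problem, under the assumptions listed there on the data, on the flux limiter and on the table of games), there exists $\mathbf F_1\in\mathcal B^3$ which is a mild kinetic solution across the (regularized) 2-1 junction.
   Context: Fixed quantities: $T>0$; an integer $n\ge 2$; speeds $0=v_1<v_2<\dots<v_n=1$; a flux threshold $p\in[0,1]$ with $p\le v_2$; $\eta_0>0$; $\epsilon>0$ and a Lipschitz continuous function $H_\epsilon:\mathbb R\to\mathbb R$ with $H_\epsilon(x)=0$ for $x\le0$, $H_\epsilon(x)=1$ for $x\ge\epsilon$, and $0\le H_\epsilon(x)\le1$ for $0<x<\epsilon$. Put $\delta^c_{1j}=0$ if $j=1$ and $\delta^c_{1j}=1$ if $j\ge2$. Function spaces. $X_T=C([0,T];\mathbb R^n)$ and $$\mathcal B=\Big\{\mathbf u\in X_T:\ 0\le u_j(t)\le1,\ \sum_{j=1}^n u_j(t)\le 1\ \ \forall j=1,\dots,n,\ \forall t\in[0,T]\Big\}.$$ A constant vector is regarded as a constant function when membership in $\mathcal B$ is asserted. $\mathcal B^3=\mathcal B\times\mathcal B\times\mathcal B$. Table of games. For $h,k,j\in\{1,\dots,n\}$ and $\rho\in[0,1]$, $A^j_{hk}[\rho]\geq 0$ are given probabilities with $\sum_{j=1}^nA^j_{hk}[\rho]=1$ for all $h,k,\rho$, and each $\rho\mapsto A^j_{hk}[\rho]$ is Lipschitz continuous on $[0,1]$. For $\mathbf f=(f_1,\dots,f_n)$ with $\rho=\sum_{j}f_j$, $$G_j[\mathbf f,\mathbf f]=\eta_0\,\rho\sum_{h,k=1}^nA^j_{hk}[\rho]f_hf_k,\qquad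 L[\mathbf f]=\eta_0\,\rho^2 .$$ Flux limiter. $\Phi:[0,1]^2\to[0,1]$ satisfies: (i) $0\le\Phi(u,v)\le1$ for all $u,v\in[0,1]$; (ii) $\Phi(u,v)u\le1-v$ for all $(u,v)\in[0,1]^2$ with $u+v>1$; (iii) there is $\mathrm{Lip}(\Phi)>0$ with $|\Phi(u_2,v_2)-\Phi(u_1,v_1)|\le\mathrm{Lip}(\Phi)(|u_2-u_1|+|v_2-v_1|)$ for all $(u_1,v_1),(u_2,v_2)\in[0,1]^2$. Data. The initial and boundary data are $\{\{\boldsymbol\varphi^r\}_{r=1}^3,\{\bar{\mathbf f}^r\}_{r=1}^2,\{\bar\Phi^r\}_{r=1}^3\}$, where $\boldsymbol\varphi^r=(\varphi^r_1,\dots,\varphi^r_n)\in\mathcal B$ are constant vectors (initial data), $\bar{\mathbf f}^r=(\bar f^r_1,\dots,\bar f^r_n)\in\mathcal B$ for $r=1,2$, $\bar\Phi^3$ is the prescribed (known) flux limiter at the end of road 3, i.e. a prescribed function of time with values in $[0,1]$, and, for $r=1,2$, $\bar\Phi^r(t)=\Phi(\bar\rho^r(t),\rho^r_1(t))$ with $\bar\rho^r=\sum_{j}\bar f^r_j$ and $\rho^r_1=\sum_jf^r_{1j}$ the density on road $r$ of the solution itself. Mild solution. A function $\mathbf F_1=(\mathbf f^1_1,\mathbf f^2_1,\mathbf f^3_1):[0,T]\to\mathbb R^n\times\mathbb R^n\times\mathbb R^n$, $\mathbf f^r_1=(f^r_{1j})_{j=1}^n$, is a mild kinetic solution across the (regularized)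 2-1 junction if $\mathbf F_1\in\mathcal B^3$ and for all $t\in[0,T]$, $j=1,\dots,n$, $$f^1_{1j}(t)=\varphi^1_j+\int_0^t\Big\{v_j\big(\bar\Phi^1\bar f^1_j-\Phi^3_{0,1}f^1_{1j}\big)+G_j[\mathbf f^1_1,\mathbf f^1_1]-f^1_{1j}L[\mathbf f^1_1]\Big\}ds,$$ $$f^2_{1j}(t)=\varphi^2_j+\int_0^t\Big\{v_j\big(\bar\Phi^2\bar f^2_j-H_\epsilon(p-(q^1_1+q^2_1))\Phi^3_{0,1}f^2_{1j}\big)+G_j[\mathbf f^2_1,\mathbf f^2_1]-f^2_{1j}L[\mathbf f^2_1]\Big\}ds,$$ $$f^3_{1j}(t)=\varphi^3_j+\int_0^t\Big\{v_j\big(\Phi^3_{0,1}\,(f^1_{1j}+H_\epsilon(p-(q^1_1+q^2_1))f^2_{1j})\,\delta^c_{1j}-\bar\Phi^3f^3_{1j}\big)+G_j[\mathbf f^3_1,\mathbf f^3_1]-f^3_{1j}L[\mathbf f^3_1]\Big\}ds,$$ all functions in the integrands being evaluated at time $s$, where $q^r_1=\sum_{j=1}^nv_jf^r_{1j}$ for $r=1,2$, $\Phi^3_{0,1}=\Phi(\rho^3_0,\rho^3_1)$, $\rho^3_1=\sum_{j=1}^nf^3_{1j}$ and $\rho^3_0=\sum_{j=2}^n\big[f^1_{1j}+H_\epsilon(p-(q^1_1+q^2_1))f^2_{1j}\big]$ (which lies in $[0,1]$ because $p\le v_2$). *)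

theory Defs
  imports "HOL-Analysis.Analysis"
begin

(* A vector of R^n is a function of type nat => real of which only the components with index
   in {1..n} are used; a time-dependent vector is a function real => nat => real of which only
   the values at times in {0..T} are used. *)

(* C([0,T]; R^n): continuity into R^n is continuity of the n components. *)
definition X_space :: "real \<Rightarrow> nat \<Rightarrow> (real \<Rightarrow> nat \<Rightarrow> real) set" where
  "X_space T n = {u. \<forall>j\<in>{1..n}. continuous_on {0..T} (\<lambda>t. u t j)}"

definition density :: "nat \<Rightarrow> (nat \<Rightarrow> real) \<Rightarrow> real" where
  "density n f = (\<Sum>j=1..n. f j)"

definition B_set :: "real \<Rightarrow> nat \<Rightarrow> (real \<Rightarrow> nat \<Rightarrow> real) set" where
  "B_set T n = {u \<in> X_space T n.
     \<forall>t\<in>{0..T}. (\<forall>j\<in>{1..n}. 0 \<le> u t j \<and> u t j \<le> 1) \<and> density n (u t) \<le> 1}"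

definition speeds :: "nat \<Rightarrow> (nat \<Rightarrow> real) \<Rightarrow> bool" where
  "speeds n v \<longleftrightarrow> v 1 = 0 \<and> strict_mono_on {1..n} v \<and> v n = 1"

definition regularized_heaviside :: "real \<Rightarrow> (real \<Rightarrow> real) \<Rightarrow> bool" where
  "regularized_heaviside \<epsilon> H \<longleftrightarrow>
     (\<exists>C. C-lipschitz_on UNIV H) \<and>
     (\<forall>x\<le>0. H x = 0) \<and> (\<forall>x\<ge>\<epsilon>. H x = 1) \<and>
     (\<forall>x. 0 < x \<and> x < \<epsilon> \<longrightarrow> 0 \<le> H x \<and> H x \<le> 1)"

(* A h k j r stands for A^j_{hk}[r]. *)
definition table_of_games :: "nat \<Rightarrow> (nat \<Rightarrow> nat \<Rightarrow> nat \<Rightarrow> real \<Rightarrow> real) \<Rightarrow> bool" where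
  "table_of_games n A \<longleftrightarrow>
     (\<forall>h\<in>{1..n}. \<forall>k\<in>{1..n}.
        (\<forall>j\<in>{1..n}. (\<forall>r\<in>{0..1}. 0 \<le> A h k j r) \<and> (\<exists>C. C-lipschitz_on {0..1} (A h k j))) \<and>
        (\<forall>r\<in>{0..1}. (\<Sum>j=1..n. A h k j r) = 1))"

definition flux_limiter :: "(real \<Rightarrow> real \<Rightarrow> real) \<Rightarrow> bool" where
  "flux_limiter \<Phi> \<longleftrightarrow>
     (\<forall>u\<in>{0..1}. \<forall>w\<in>{0..1}. 0 \<le> \<Phi> u w \<and> \<Phi> u w \<le> 1) \<and>
     (\<forall>u\<in>{0..1}. \<forall>w\<in>{0..1}. u + w > 1 \<longrightarrow> \<Phi> u w * u \<le> 1 - w) \<and>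
     (\<exists>C>0. \<forall>u1\<in>{0..1}. \<forall>w1\<in>{0..1}. \<forall>u2\<in>{0..1}. \<forall>w2\<in>{0..1}.
        \<bar>\<Phi> u2 w2 - \<Phi> u1 w1\<bar> \<le> C * (\<bar>u2 - u1\<bar> + \<bar>w2 - w1\<bar>))"

definition gain ::
  "real \<Rightarrow> nat \<Rightarrow> (nat \<Rightarrow> nat \<Rightarrow> nat \<Rightarrow> real \<Rightarrow> real) \<Rightarrow> (nat \<Rightarrow> real) \<Rightarrow> nat \<Rightarrow> real" where
  "gain \<eta>0 n A f j =
     \<eta>0 * density n f * (\<Sum>h=1..n. \<Sum>k=1..n. A h k j (density n f) * f h * f k)"

definition loss :: "real \<Rightarrow> nat \<Rightarrow> (nat \<Rightarrow> real) \<Rightarrow> real" where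
  "loss \<eta>0 n f = \<eta>0 * (density n f)\<^sup>2"

definition flux :: "nat \<Rightarrow> (nat \<Rightarrow> real) \<Rightarrow> (nat \<Rightarrow> real) \<Rightarrow> real" where
  "flux n v f = (\<Sum>j=1..n. v j * f j)"

definition delta_c :: "nat \<Rightarrow> real" where
  "delta_c j = (if j = 1 then 0 else 1)"

(* H_eps(p - (q^1 + q^2)), the switch governing access from road 2, given the states of
   roads 1 and 2. *)
definition access ::
  "nat \<Rightarrow> (nat \<Rightarrow> real) \<Rightarrow> real \<Rightarrow> (real \<Rightarrow> real) \<Rightarrow> (nat \<Rightarrow> real) \<Rightarrow> (nat \<Rightarrow> real) \<Rightarrow> real" where
  "access n v p H f1 f2 = H (p - (flux n v f1 + flux n v f2))"

(* rho^3_0. *)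
definition inflow_density ::
  "nat \<Rightarrow> (nat \<Rightarrow> real) \<Rightarrow> real \<Rightarrow> (real \<Rightarrow> real) \<Rightarrow> (nat \<Rightarrow> real) \<Rightarrow> (nat \<Rightarrow> real) \<Rightarrow> real" where
  "inflow_density n v p H f1 f2 = (\<Sum>j=2..n. (f1 j + access n v p H f1 f2 * f2 j))"

(* Phi^3_{0,1} = Phi(rho^3_0, rho^3_1). *)
definition junction_limiter ::
  "nat \<Rightarrow> (nat \<Rightarrow> real) \<Rightarrow> real \<Rightarrow> (real \<Rightarrow> real) \<Rightarrow> (real \<Rightarrow> real \<Rightarrow> real) \<Rightarrow>
   (nat \<Rightarrow> real) \<Rightarrow> (nat \<Rightarrow> real) \<Rightarrow> (nat \<Rightarrow> real) \<Rightarrow> real" where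
  "junction_limiter n v p H \<Phi> f1 f2 f3 = \<Phi> (inflow_density n v p H f1 f2) (density n f3)"

(* The integral equation f_j(t) = phi_j + int_0^t R_j ds on [0,T]. Lebesgue integrability of R_j
   is part of the notion: integral is 0 on non-integrable functions. *)
definition integral_equation ::
  "real \<Rightarrow> nat \<Rightarrow> (nat \<Rightarrow> real) \<Rightarrow> (real \<Rightarrow> nat \<Rightarrow> real) \<Rightarrow> (real \<Rightarrow> nat \<Rightarrow> real) \<Rightarrow> bool" where
  "integral_equation T n \<phi> R f \<longleftrightarrow>
     (\<forall>t\<in>{0..T}. \<forall>j\<in>{1..n}.
        (\<lambda>s. R s j) absolutely_integrable_on {0..t} \<and>
        f t j = \<phi> j + integral {0..t} (\<lambda>s. R s j))"

(* fb1, fb2 and Pb3 are the boundary data of roads 1, 2 and 3. The boundary limiters of roads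
   1 and 2 are Phi(rho-bar^r, rho^r_1), so they involve the solution itself. *)
definition mild_kinetic_solution_21 ::
  "real \<Rightarrow> nat \<Rightarrow> (nat \<Rightarrow> real) \<Rightarrow> real \<Rightarrow> real \<Rightarrow> (real \<Rightarrow> real) \<Rightarrow>
   (nat \<Rightarrow> nat \<Rightarrow> nat \<Rightarrow> real \<Rightarrow> real) \<Rightarrow> (real \<Rightarrow> real \<Rightarrow> real) \<Rightarrow>
   (nat \<Rightarrow> real) \<Rightarrow> (nat \<Rightarrow> real) \<Rightarrow> (nat \<Rightarrow> real) \<Rightarrow>
   (real \<Rightarrow> nat \<Rightarrow> real) \<Rightarrow> (real \<Rightarrow> nat \<Rightarrow> real) \<Rightarrow> (real \<Rightarrow> real) \<Rightarrow>
   (real \<Rightarrow> nat \<Rightarrow> real) \<times> (real \<Rightarrow> nat \<Rightarrow> real) \<times> (real \<Rightarrow> nat \<Rightarrow> real) \<Rightarrow> bool" where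
  "mild_kinetic_solution_21 T n v p \<eta>0 H A \<Phi> \<phi>1 \<phi>2 \<phi>3 fb1 fb2 Pb3 F \<longleftrightarrow>
     F \<in> B_set T n \<times> B_set T n \<times> B_set T n \<and>
     (case F of (f1, f2, f3) \<Rightarrow>
        integral_equation T n \<phi>1
          (\<lambda>s j. v j * (\<Phi> (density n (fb1 s)) (density n (f1 s)) * fb1 s j
                        - junction_limiter n v p H \<Phi> (f1 s) (f2 s) (f3 s) * f1 s j)
                 + gain \<eta>0 n A (f1 s) j - f1 s j * loss \<eta>0 n (f1 s)) f1 \<and>
        integral_equation T n \<phi>2
          (\<lambda>s j. v j * (\<Phi> (density n (fb2 s)) (density n (f2 s)) * fb2 s j
                        - access n v p H (f1 s) (f2 s)
                          * junction_limiter n v p H \<Phi> (f1 s) (f2 s) (f3 s) * f2 s j)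
                 + gain \<eta>0 n A (f2 s) j - f2 s j * loss \<eta>0 n (f2 s)) f2 \<and>
        integral_equation T n \<phi>3
          (\<lambda>s j. v j * (junction_limiter n v p H \<Phi> (f1 s) (f2 s) (f3 s)
                          * (f1 s j + access n v p H (f1 s) (f2 s) * f2 s j) * delta_c j
                        - Pb3 s * f3 s j)
                 + gain \<eta>0 n A (f3 s) j - f3 s j * loss \<eta>0 n (f3 s)) f3)"

end

(* Each road satisfies an equation f' = R in which the interactions conserve the density, the
   outgoing and loss terms are proportional to the component, and the flux limiter bounds the
   inflow by the free space 1 - rho of the road. Hence for small h the Euler step x + h R(t, x) maps
   the polyhedron of admissible states into itself. With l = 1 / h the equation is equivalent to
     x(t) = exp(-l t) phi + int_0^t l exp(-l (t - s)) (x + h R(s, x))(s) ds,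
   whose right-hand side is a convex combination of admissible states. The Picard iteration for
   this form therefore never leaves the polyhedron, on which R is Lipschitz in x, and it converges
   geometrically in a norm weighted by exp(-2 M t). The prescribed limiter at the end of road 3 is
   only measurable in time, so the equation is of Caratheodory type. *)

theory Submission
  imports Defs
begin

section \<open>Integrals of bounded measurable functions\<close>

text \<open>The obstacle is that \<open>\<Phi>\<close> and the table of games are controlled only on
  unit intervals, so the right-hand side is under control only at admissible states, and nothing
  keeps a plain Picard iterate among them. In the exponential form the weights
  \<open>exp (- l * t)\<close> and \<open>l * exp (- l * (t - s))\<close> are positive with total
  mass 1, so the iteration inherits whatever one Euler step preserves. This forces a single step
  \<open>h\<close> for all times and states. The exponent \<open>2 * M * t\<close> carries twice a
  Lipschitz constant, so that one integration gains a factor 1/2 on all of [0,T] and no local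
  solutions have to be glued. Returning from the exponential form calls for a product rule for
  primitives of functions that are merely bounded and measurable, where a pointwise derivative may
  fail to exist; it is obtained from increments that are quadratic in the length of the interval.
  The bound p \<le> v_2 serves to keep the first argument of the junction limiter in [0,1], where
  the limiter hypotheses apply.\<close>

definition bounded_measurable_on :: "real \<Rightarrow> (real \<Rightarrow> real) \<Rightarrow> bool" where
  "bounded_measurable_on T g \<longleftrightarrow>
     g \<in> borel_measurable (lebesgue_on {0..T}) \<and> (\<exists>B. \<forall>t\<in>{0..T}. \<bar>g t\<bar> \<le> B)"

lemma bounded_measurable_on_continuous:
  assumes "continuous_on {0..T} g"
  shows "bounded_measurable_on T g"
proof -
  have "bounded (g ` {0..T})"
    using assms by (intro compact_imp_bounded compact_continuous_image) auto
  then show ?thesis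
    using assms unfolding bounded_measurable_on_def bounded_iff
    by (auto intro: continuous_imp_measurable_on_sets_lebesgue)
qed

lemma bounded_measurable_on_add:
  assumes "bounded_measurable_on T f" "bounded_measurable_on T g"
  shows "bounded_measurable_on T (\<lambda>t. f t + g t)"
proof -
  obtain B C where "\<forall>t\<in>{0..T}. \<bar>f t\<bar> \<le> B" "\<forall>t\<in>{0..T}. \<bar>g t\<bar> \<le> C"
    using assms unfolding bounded_measurable_on_def by blast
  then have "\<forall>t\<in>{0..T}. \<bar>f t + g t\<bar> \<le> B + C"
    by (meson abs_triangle_ineq add_mono order_trans)
  then show ?thesis
    using assms unfolding bounded_measurable_on_def by auto
qed

lemma bounded_measurable_on_mult:
  assumes "bounded_measurable_on T f" "bounded_measurable_on T g"
  shows "bounded_measurable_on T (\<lambda>t. f t * g t)"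
proof -
  obtain B C where "\<forall>t\<in>{0..T}. \<bar>f t\<bar> \<le> B" "\<forall>t\<in>{0..T}. \<bar>g t\<bar> \<le> C"
    using assms unfolding bounded_measurable_on_def by blast
  then have "\<forall>t\<in>{0..T}. \<bar>f t * g t\<bar> \<le> B * C"
    unfolding abs_mult by (metis abs_ge_zero mult_mono order_trans)
  then show ?thesis
    using assms unfolding bounded_measurable_on_def by auto
qed

lemma bounded_measurable_on_sum:
  assumes "\<And>i. i \<in> I \<Longrightarrow> bounded_measurable_on T (f i)"
  shows "bounded_measurable_on T (\<lambda>t. \<Sum>i\<in>I. f i t)"
  using assms
  by (induction I rule: infinite_finite_induct)
    (auto intro: bounded_measurable_on_add bounded_measurable_on_continuous)

lemma bounded_measurable_on_absolutely_integrable: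
  assumes "bounded_measurable_on T g" "0 \<le> a" "b \<le> T"
  shows "g absolutely_integrable_on {a..b}"
proof -
  obtain B where "\<forall>t\<in>{0..T}. \<bar>g t\<bar> \<le> B" and m: "g \<in> borel_measurable (lebesgue_on {0..T})"
    using assms(1) unfolding bounded_measurable_on_def by blast
  then have "g absolutely_integrable_on {0..T}"
    by (intro measurable_bounded_by_integrable_imp_absolutely_integrable[where g = "\<lambda>_. B"])
       auto
  then show ?thesis
    using assms by (auto intro: absolutely_integrable_on_subinterval)
qed

lemma bounded_measurable_on_integrable:
  assumes "bounded_measurable_on T g" "0 \<le> a" "b \<le> T"
  shows "g integrable_on {a..b}"
  using bounded_measurable_on_absolutely_integrable[OF assms]
  by (rule set_lebesgue_integral_eq_integral(1))

lemma bounded_measurable_on_indefinite_integral: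
  assumes "bounded_measurable_on T g"
  shows "continuous_on {0..T} (\<lambda>t. integral {0..t} g)"
  using assms by (intro indefinite_integral_continuous_1 bounded_measurable_on_integrable) auto

lemma bounded_measurable_on_integral_diff:
  assumes "bounded_measurable_on T g" "0 \<le> s" "s \<le> t" "t \<le> T"
  shows "integral {0..t} g - integral {0..s} g = integral {s..t} g"
  using Henstock_Kurzweil_Integration.integral_combine[of 0 s t g]
    bounded_measurable_on_integrable[OF assms(1), of 0 t] assms by simp

lemma bounded_measurable_on_integral_bound:
  assumes "bounded_measurable_on T g" "0 \<le> s" "s \<le> t" "t \<le> T"
    and "\<And>r. r \<in> {s..t} \<Longrightarrow> \<bar>g r\<bar> \<le> B"
  shows "\<bar>integral {s..t} g\<bar> \<le> B * (t - s)"
  using integral_norm_bound_integral[of g "{s..t}" "\<lambda>_. B"]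
    bounded_measurable_on_integrable[OF assms(1), of s t] integrable_const_ivl[of B s t] assms
  by (simp add: mult.commute)

text \<open>The difference of the two sides has increments of order \<open>(t - s)\<^sup>2\<close>, hence derivative zero.\<close>

lemma indefinite_integral_mult:
  fixes f g u w :: "real \<Rightarrow> real"
  assumes f: "bounded_measurable_on T f" and g: "bounded_measurable_on T g"
    and u: "\<And>t. t \<in> {0..T} \<Longrightarrow> u t = a + integral {0..t} f"
    and w: "\<And>t. t \<in> {0..T} \<Longrightarrow> w t = b + integral {0..t} g"
    and t: "t \<in> {0..T}"
  shows "u t * w t = a * b + integral {0..t} (\<lambda>s. f s * w s + u s * g s)"
proof -
  obtain B where B: "\<forall>t\<in>{0..T}. \<bar>f t\<bar> \<le> B"
    using f unfolding bounded_measurable_on_def by blast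
  obtain C where C: "\<forall>t\<in>{0..T}. \<bar>g t\<bar> \<le> C"
    using g unfolding bounded_measurable_on_def by blast
  have B0: "0 \<le> B" and C0: "0 \<le> C" using B C t by fastforce+
  have cu: "continuous_on {0..T} u"
    using bounded_measurable_on_indefinite_integral[OF f]
    by (subst continuous_on_cong[OF refl u]) (auto intro!: continuous_intros)
  have cw: "continuous_on {0..T} w"
    using bounded_measurable_on_indefinite_integral[OF g]
    by (subst continuous_on_cong[OF refl w]) (auto intro!: continuous_intros)
  let ?h = "\<lambda>s. f s * w s + u s * g s"
  have h: "bounded_measurable_on T ?h"
    by (intro bounded_measurable_on_add bounded_measurable_on_mult f g
        bounded_measurable_on_continuous[OF cu] bounded_measurable_on_continuous[OF cw])
  define F where "F t = u t * w t - integral {0..t} ?h" for t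
  have inc: "\<bar>F t - F s\<bar> \<le> 2 * B * C * (t - s)\<^sup>2" if st: "0 \<le> s" "s \<le> t" "t \<le> T" for s t
  proof -
    have du: "\<bar>u t - u r\<bar> \<le> B * (t - s)" if r: "r \<in> {s..t}" for r
    proof -
      have "\<bar>u t - u r\<bar> \<le> B * (t - r)"
        using u[of t] u[of r] bounded_measurable_on_integral_diff[OF f, of r t]
          bounded_measurable_on_integral_bound[OF f, of r t B] B st r by simp
      also have "\<dots> \<le> B * (t - s)"
        using r B0 by (intro mult_left_mono) auto
      finally show ?thesis .
    qed
    have dw: "\<bar>w s - w r\<bar> \<le> C * (t - s)" if r: "r \<in> {s..t}" for r
    proof -
      have "\<bar>w s - w r\<bar> \<le> C * (r - s)"
        using w[of s] w[of r] bounded_measurable_on_integral_diff[OF g, of s r]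
          bounded_measurable_on_integral_bound[OF g, of s r C] C st r by simp
      also have "\<dots> \<le> C * (t - s)"
        using r C0 by (intro mult_left_mono) auto
      finally show ?thesis .
    qed
    let ?k = "\<lambda>r. (u t - u r) * g r + f r * (w s - w r)"
    have k: "bounded_measurable_on T ?k"
      using cu cw
      by (intro bounded_measurable_on_add bounded_measurable_on_mult f g
          bounded_measurable_on_continuous[of T "\<lambda>r. u t - u r"]
          bounded_measurable_on_continuous[of T "\<lambda>r. w s - w r"] continuous_intros)
    \<comment> \<open>Freezing \<open>u\<close> at the right end and \<open>w\<close> at the left
      end makes the increment of the product an exact integral. Subtracting the integral of
      \<open>?h\<close> then leaves only the oscillations of \<open>u\<close> and \<open>w\<close>:
      each of the two terms of \<open>?k\<close> is at most \<open>B * C * (t - s)\<close>, and the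
      length of the interval gives the second factor \<open>t - s\<close>.\<close>
    have "u t * w t - u s * w s = u t * (w t - w s) + (u t - u s) * w s"
      by (simp add: algebra_simps)
    also have "\<dots> = u t * integral {s..t} g + integral {s..t} f * w s"
      using u[of t] u[of s] w[of t] w[of s] st bounded_measurable_on_integral_diff[OF f, of s t]
        bounded_measurable_on_integral_diff[OF g, of s t] by auto
    also have "\<dots> = integral {s..t} (\<lambda>r. u t * g r + f r * w s)"
      using bounded_measurable_on_integrable[OF f, of s t]
        bounded_measurable_on_integrable[OF g, of s t] st
      by (subst integral_add) (auto intro!: integrable_on_mult_right integrable_on_mult_left)
    finally have "F t - F s = integral {s..t} (\<lambda>r. u t * g r + f r * w s) - integral {s..t} ?h"
      using bounded_measurable_on_integral_diff[OF h st] unfolding F_def by simp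
    also have "\<dots> = integral {s..t} ?k"
      using bounded_measurable_on_integrable[OF f, of s t]
        bounded_measurable_on_integrable[OF g, of s t]
        bounded_measurable_on_integrable[OF h, of s t] st
      by (subst integral_diff[symmetric])
        (auto intro!: integrable_on_mult_right integrable_on_mult_left integrable_add
          simp: algebra_simps)
    also have "\<bar>\<dots>\<bar> \<le> (2 * B * C * (t - s)) * (t - s)"
    proof (rule bounded_measurable_on_integral_bound[OF k st])
      fix r assume r: "r \<in> {s..t}"
      have "\<bar>?k r\<bar> \<le> \<bar>u t - u r\<bar> * \<bar>g r\<bar> + \<bar>f r\<bar> * \<bar>w s - w r\<bar>"
        by (metis abs_mult abs_triangle_ineq)
      also have "\<dots> \<le> (B * (t - s)) * C + B * (C * (t - s))"
        using du[OF r] dw[OF r] B C B0 C0 r st by (intro add_mono mult_mono) auto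
      finally show "\<bar>?k r\<bar> \<le> 2 * B * C * (t - s)"
        by (simp add: algebra_simps)
    qed
    finally show ?thesis by (simp add: power2_eq_square)
  qed
  have "(F has_derivative (\<lambda>_. 0)) (at x within {0..T})" if x: "x \<in> {0..T}" for x
  proof (rule has_derivativeI_sandwich[of 1 _ _ _ _ "\<lambda>y. 2 * B * C * \<bar>y - x\<bar>"])
    show "norm ((F y - F x) - 0) / norm (y - x) \<le> 2 * B * C * \<bar>y - x\<bar>"
      if "y \<in> {0..T}" "y \<noteq> x" for y
      using inc[of x y] inc[of y x] x that
      by (cases "x \<le> y") (auto simp: divide_simps power2_eq_square abs_minus_commute mult.assoc)
    show "((\<lambda>y. 2 * B * C * \<bar>y - x\<bar>) \<longlongrightarrow> 0) (at x within {0..T})"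
      by (auto intro!: tendsto_eq_intros)
  qed auto
  then have "F t = F 0"
    using has_derivative_zero_constant[of "{0..T}" F] t by fastforce
  moreover have "F 0 = a * b"
    using u[of 0] w[of 0] t unfolding F_def by simp
  ultimately show ?thesis unfolding F_def by simp
qed

text \<open>Formally y' = - l y + (l y + k) = k. The product rule for primitives makes this
  rigorous: differentiating the exponential factor contributes \<open>- l * y s\<close>, which
  cancels the term \<open>l * y s\<close> of the integrand.\<close>

lemma exponential_weight_fixed_point:
  assumes k: "bounded_measurable_on T k"
    and y: "\<And>t. t \<in> {0..T} \<Longrightarrow>
      y t = exp (- l * t) * (c + integral {0..t} (\<lambda>s. exp (l * s) * (l * y s + k s)))"
    and cy: "continuous_on {0..T} y" and t: "t \<in> {0..T}"
  shows "y t = c + integral {0..t} k"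
proof -
  let ?w = "\<lambda>t. c + integral {0..t} (\<lambda>s. exp (l * s) * (l * y s + k s))"
  let ?f = "\<lambda>s. - l * exp (- l * s)"
  have g: "bounded_measurable_on T (\<lambda>s. exp (l * s) * (l * y s + k s))"
    using cy
    by (intro bounded_measurable_on_add bounded_measurable_on_mult k
        bounded_measurable_on_continuous[of T y]
        bounded_measurable_on_continuous[of T "\<lambda>s. exp (l * s)"]
        bounded_measurable_on_continuous[of T "\<lambda>s. l"] continuous_intros)
  have f: "bounded_measurable_on T ?f"
    by (intro bounded_measurable_on_continuous continuous_intros)
  have u: "exp (- l * t) = 1 + integral {0..t} ?f" if "t \<in> {0..T}" for t
  proof -
    have "(?f has_integral (exp (- l * t) - exp (- l * 0))) {0..t}"
      using that by (intro fundamental_theorem_of_calculus)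
       (auto intro!: derivative_eq_intros simp flip: has_real_derivative_iff_has_vector_derivative)
    then have "integral {0..t} ?f = exp (- l * t) - exp (- l * 0)"
      by (rule integral_unique)
    then show ?thesis by simp
  qed
  have "y t = exp (- l * t) * ?w t"
    by (rule y[OF t])
  also have "\<dots> = 1 * c + integral {0..t}
      (\<lambda>s. ?f s * ?w s + exp (- l * s) * (exp (l * s) * (l * y s + k s)))"
    by (rule indefinite_integral_mult[OF f g u refl t])
  also have "integral {0..t} (\<lambda>s. ?f s * ?w s + exp (- l * s) * (exp (l * s) * (l * y s + k s)))
    = integral {0..t} k"
  proof (rule integral_cong)
    fix s assume "s \<in> {0..t}"
    then have "?f s * ?w s = - l * y s"
      using y[of s] t by simp
    moreover have "exp (- l * s) * (exp (l * s) * (l * y s + k s)) = l * y s + k s"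
      by (simp flip: mult.assoc exp_add)
    ultimately show "?f s * ?w s + exp (- l * s) * (exp (l * s) * (l * y s + k s)) = k s"
      by linarith
  qed
  finally show ?thesis by simp
qed

section \<open>Viability for Caratheodory equations in a polyhedron\<close>

text \<open>A state is a function on the whole index type of which only the coordinates in
  \<open>I\<close> matter, so a finite sum replaces a norm. A sum of coordinates commutes with
  integrals and adds up componentwise Lipschitz bounds.\<close>

definition l1_dist :: "'i set \<Rightarrow> ('i \<Rightarrow> real) \<Rightarrow> ('i \<Rightarrow> real) \<Rightarrow> real" where
  "l1_dist I x y = (\<Sum>i\<in>I. \<bar>x i - y i\<bar>)"

text \<open>The polyhedron is kept as its family of inequalities. Each of them is linear and passes
  separately through an integral and a pointwise limit, which replaces arguments with convexity and
  closedness.\<close>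

definition half_spaces :: "'i set \<Rightarrow> (('i \<Rightarrow> real) \<times> real) set \<Rightarrow> ('i \<Rightarrow> real) set" where
  "half_spaces I P = {x. \<forall>(a, b)\<in>P. (\<Sum>i\<in>I. a i * x i) \<le> b}"

definition curves :: "real \<Rightarrow> 'i set \<Rightarrow> ('i \<Rightarrow> real) set \<Rightarrow> (real \<Rightarrow> 'i \<Rightarrow> real) set" where
  "curves T I K = {x. (\<forall>i\<in>I. continuous_on {0..T} (\<lambda>t. x t i)) \<and> (\<forall>t\<in>{0..T}. x t \<in> K)}"

text \<open>These are Caratheodory conditions with constants uniform in time. Boundedness makes
  products Lipschitz again. Measurability is required along continuous curves instead of at fixed
  states, because this is directly the measurability of the integrands and it is inherited by sums,
  products and compositions.\<close>

definition admissible ::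
  "real \<Rightarrow> 'i set \<Rightarrow> ('i \<Rightarrow> real) set \<Rightarrow> (real \<Rightarrow> ('i \<Rightarrow> real) \<Rightarrow> real) \<Rightarrow> bool" where
  "admissible T I K f \<longleftrightarrow>
     (\<exists>B. \<forall>t\<in>{0..T}. \<forall>x\<in>K. \<bar>f t x\<bar> \<le> B) \<and>
     (\<exists>C\<ge>0. \<forall>t\<in>{0..T}. \<forall>x\<in>K. \<forall>y\<in>K. \<bar>f t x - f t y\<bar> \<le> C * l1_dist I x y) \<and>
     (\<forall>x\<in>curves T I K. (\<lambda>t. f t (x t)) \<in> borel_measurable (lebesgue_on {0..T}))"

lemma l1_dist_nonneg: "0 \<le> l1_dist I x y"
  unfolding l1_dist_def by (simp add: sum_nonneg)

lemma l1_dist_component: "finite I \<Longrightarrow> i \<in> I \<Longrightarrow> \<bar>x i - y i\<bar> \<le> l1_dist I x y"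
  unfolding l1_dist_def by (rule member_le_sum) auto

lemma uniform_limit_sum:
  fixes f :: "'i \<Rightarrow> 'b \<Rightarrow> 'c \<Rightarrow> real"
  assumes "\<And>i. i \<in> I \<Longrightarrow> uniform_limit S (f i) (g i) F"
  shows "uniform_limit S (\<lambda>k t. \<Sum>i\<in>I. f i k t) (\<lambda>t. \<Sum>i\<in>I. g i t) F"
  using assms
  by (induction I rule: infinite_finite_induct) (auto intro!: uniform_limit_intros)

lemma curves_continuous: "x \<in> curves T I K \<Longrightarrow> i \<in> I \<Longrightarrow> continuous_on {0..T} (\<lambda>t. x t i)"
  and curves_mem: "x \<in> curves T I K \<Longrightarrow> t \<in> {0..T} \<Longrightarrow> x t \<in> K"
  by (auto simp: curves_def)

lemma admissible_along_curve:
  assumes "admissible T I K f" "x \<in> curves T I K"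
  shows "bounded_measurable_on T (\<lambda>t. f t (x t))"
proof -
  obtain B where "\<forall>t\<in>{0..T}. \<forall>x\<in>K. \<bar>f t x\<bar> \<le> B"
    using assms(1) unfolding admissible_def by blast
  then have "\<forall>t\<in>{0..T}. \<bar>f t (x t)\<bar> \<le> B"
    using curves_mem[OF assms(2)] by blast
  then show ?thesis
    using assms unfolding admissible_def bounded_measurable_on_def by blast
qed

lemma integral_exp:
  fixes t c :: real
  assumes "0 \<le> t" "c \<noteq> 0"
  shows "integral {0..t} (\<lambda>s. exp (c * s)) = (exp (c * t) - 1) / c"
proof -
  have "((\<lambda>s. exp (c * s)) has_integral (exp (c * t) / c - exp (c * 0) / c)) {0..t}"
    using assms by (intro fundamental_theorem_of_calculus[where f = "\<lambda>s. exp (c * s) / c"])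
      (auto intro!: derivative_eq_intros simp flip: has_real_derivative_iff_has_vector_derivative)
  then show ?thesis by (simp add: integral_unique diff_divide_distrib)
qed

text \<open>Nagumo's tangency condition would only ask that the distance of \<open>x + h R\<close>
  to the set be o(h) as h tends to 0. Here one \<open>h\<close> serves all times and states, which
  yields one rate \<open>1 / h\<close> for the exponential form.\<close>

locale subtangential_field =
  fixes T :: real and I :: "'i set" and P :: "(('i \<Rightarrow> real) \<times> real) set"
    and R :: "real \<Rightarrow> ('i \<Rightarrow> real) \<Rightarrow> 'i \<Rightarrow> real" and \<phi> :: "'i \<Rightarrow> real" and h :: real
  assumes T_nonneg: "0 \<le> T" and fin: "finite I" and h_pos: "0 < h"
    and init: "\<phi> \<in> half_spaces I P"
    and adm: "\<And>i. i \<in> I \<Longrightarrow> admissible T I (half_spaces I P) (\<lambda>t x. R t x i)"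
    and subtangential: "\<And>t x. t \<in> {0..T} \<Longrightarrow> x \<in> half_spaces I P \<Longrightarrow>
      (\<lambda>i. x i + h * R t x i) \<in> half_spaces I P"
begin

abbreviation K where "K \<equiv> half_spaces I P"

abbreviation l where "l \<equiv> 1 / h"

text \<open>Variation of constants for x' = - l x + (l x + R). The factor
  \<open>exp (- l * t)\<close> stands outside the integral, so the integrand does not depend on the
  upper limit.\<close>

definition picard :: "(real \<Rightarrow> 'i \<Rightarrow> real) \<Rightarrow> real \<Rightarrow> 'i \<Rightarrow> real" where
  "picard x t i =
     exp (- l * t) * (\<phi> i + integral {0..t} (\<lambda>s. exp (l * s) * (l * x s i + R s (x s) i)))"

lemma half_spaces_le: "x \<in> K \<Longrightarrow> (a, b) \<in> P \<Longrightarrow> (\<Sum>i\<in>I. a i * x i) \<le> b"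
  unfolding half_spaces_def by blast

lemma integrand_bounded_measurable:
  assumes "x \<in> curves T I K" "i \<in> I"
  shows "bounded_measurable_on T (\<lambda>s. exp (l * s) * (l * x s i + R s (x s) i))"
  using curves_continuous[OF assms]
  by (intro bounded_measurable_on_add bounded_measurable_on_mult
      admissible_along_curve[OF adm[OF assms(2)] assms(1)]
      bounded_measurable_on_continuous[of T "\<lambda>s. exp (l * s)"]
      bounded_measurable_on_continuous[of T "\<lambda>s. x s i"]
      bounded_measurable_on_continuous[of T "\<lambda>s. l"] continuous_intros)

text \<open>For a single constraint a.x \<le> b, the vector \<open>l * x + R\<close> is
  \<open>l\<close> times an Euler step, so its product with a is at most \<open>l * b\<close>.
  Integrating against \<open>exp (l * s)\<close> gives \<open>b * (exp (l * t) - 1)\<close>; the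
  initial value supplies the missing \<open>b\<close>, and \<open>exp (- l * t)\<close> turns the
  sum back into \<open>b\<close>.\<close>

lemma picard_curves:
  assumes x: "x \<in> curves T I K"
  shows "picard x \<in> curves T I K"
proof -
  have "continuous_on {0..T} (\<lambda>t. picard x t i)" if "i \<in> I" for i
    unfolding picard_def
    by (intro continuous_intros
        bounded_measurable_on_indefinite_integral[OF integrand_bounded_measurable[OF x that]])
  moreover have "picard x t \<in> K" if t: "t \<in> {0..T}" for t
  proof -
    have "(\<Sum>i\<in>I. a i * picard x t i) \<le> b" if ab: "(a, b) \<in> P" for a b
    proof -
      let ?g = "\<lambda>i s. exp (l * s) * (l * x s i + R s (x s) i)"
      have int: "?g i integrable_on {0..t}" if "i \<in> I" for i
        using bounded_measurable_on_integrable[OF integrand_bounded_measurable[OF x that], of 0 t] t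
        by simp
      have sum_g: "(\<Sum>i\<in>I. a i * integral {0..t} (?g i)) = integral {0..t} (\<lambda>s. \<Sum>i\<in>I. a i * ?g i s)"
        using int fin by (subst integral_sum) (auto intro!: integrable_on_mult_right)
      also have "\<dots> \<le> integral {0..t} (\<lambda>s. l * b * exp (l * s))"
      proof (rule integral_le)
        show "(\<lambda>s. \<Sum>i\<in>I. a i * ?g i s) integrable_on {0..t}"
          using int fin by (intro integrable_sum integrable_on_mult_right) auto
        show "(\<lambda>s. l * b * exp (l * s)) integrable_on {0..t}"
          by (intro integrable_continuous_interval continuous_intros)
        fix s assume s: "s \<in> {0..t}"
        have "(\<Sum>i\<in>I. a i * ?g i s) = exp (l * s) * l * (\<Sum>i\<in>I. a i * (x s i + h * R s (x s) i))"
          using h_pos by (simp add: sum_distrib_left algebra_simps)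
        also have "\<dots> \<le> exp (l * s) * l * b"
          using s t h_pos
          by (intro mult_left_mono half_spaces_le[OF subtangential ab] curves_mem[OF x]) auto
        finally show "(\<Sum>i\<in>I. a i * ?g i s) \<le> l * b * exp (l * s)" by (simp add: mult_ac)
      qed
      also have "\<dots> = b * (exp (l * t) - 1)"
        using integral_exp[of t l] t h_pos by simp
      finally have le: "(\<Sum>i\<in>I. a i * integral {0..t} (?g i)) \<le> b * (exp (l * t) - 1)" .
      have "(\<Sum>i\<in>I. a i * picard x t i)
        = exp (- l * t) * ((\<Sum>i\<in>I. a i * \<phi> i) + (\<Sum>i\<in>I. a i * integral {0..t} (?g i)))"
        unfolding picard_def by (simp add: sum_distrib_left sum.distrib distrib_left mult_ac)
      also have "\<dots> \<le> exp (- l * t) * (b + b * (exp (l * t) - 1))"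
        using le half_spaces_le[OF init ab] by (intro mult_left_mono add_mono) auto
      also have "\<dots> = b"
        by (simp add: algebra_simps flip: exp_add)
      finally show ?thesis .
    qed
    then show ?thesis unfolding half_spaces_def by blast
  qed
  ultimately show ?thesis unfolding curves_def by blast
qed

lemma field_lipschitz:
  obtains C where "0 \<le> C"
    "\<And>t x y. t \<in> {0..T} \<Longrightarrow> x \<in> K \<Longrightarrow> y \<in> K \<Longrightarrow>
       l1_dist I (R t x) (R t y) \<le> C * l1_dist I x y"
proof -
  have "\<exists>C\<ge>0. \<forall>t\<in>{0..T}. \<forall>x\<in>K. \<forall>y\<in>K. \<bar>R t x i - R t y i\<bar> \<le> C * l1_dist I x y" if "i \<in> I" for i
    using adm[OF that] unfolding admissible_def by blast
  then obtain C where C: "\<And>i. i \<in> I \<Longrightarrow> 0 \<le> C i"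
    "\<And>i t x y. i \<in> I \<Longrightarrow> t \<in> {0..T} \<Longrightarrow> x \<in> K \<Longrightarrow> y \<in> K \<Longrightarrow>
       \<bar>R t x i - R t y i\<bar> \<le> C i * l1_dist I x y"
    by metis
  show ?thesis
  proof
    show "0 \<le> (\<Sum>i\<in>I. C i)" by (intro sum_nonneg C)
    show "l1_dist I (R t x) (R t y) \<le> (\<Sum>i\<in>I. C i) * l1_dist I x y"
      if "t \<in> {0..T}" "x \<in> K" "y \<in> K" for t x y
      using C(2)[OF _ that] unfolding l1_dist_def[of I "R t x"] sum_distrib_right
      by (intro sum_mono) auto
  qed
qed

text \<open>The weighted norm appears only through a number \<open>D\<close> that bounds the
  weighted distance at all times, so no supremum is formed. The gain 1/2 is the integral of
  \<open>M * exp (2 * M * s)\<close>, which is half of \<open>exp (2 * M * t) - 1\<close>.\<close>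

lemma picard_contraction:
  obtains M where "0 < M"
    "\<And>x y D. x \<in> curves T I K \<Longrightarrow> y \<in> curves T I K \<Longrightarrow>
       (\<And>t. t \<in> {0..T} \<Longrightarrow> l1_dist I (x t) (y t) \<le> D * exp (2 * M * t)) \<Longrightarrow>
       (\<And>t. t \<in> {0..T} \<Longrightarrow> l1_dist I (picard x t) (picard y t) \<le> D / 2 * exp (2 * M * t))"
proof -
  obtain C where C: "0 \<le> C"
    "\<And>t x y. t \<in> {0..T} \<Longrightarrow> x \<in> K \<Longrightarrow> y \<in> K \<Longrightarrow>
       l1_dist I (R t x) (R t y) \<le> C * l1_dist I x y"
    using field_lipschitz by blast
  \<comment> \<open>A Lipschitz constant of the map \<open>l * x + R\<close> in the l1
    distance.\<close>
  define M where "M = l + C"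
  have M: "0 < M" using h_pos C(1) by (simp add: M_def add_pos_nonneg)
  show ?thesis
  proof
    show "0 < M" by (rule M)
  next
    fix x y D t
    assume x: "x \<in> curves T I K" and y: "y \<in> curves T I K"
      and D: "\<And>t. t \<in> {0..T} \<Longrightarrow> l1_dist I (x t) (y t) \<le> D * exp (2 * M * t)"
      and t: "t \<in> {0..T}"
    have D0: "0 \<le> D"
      using D[of 0] T_nonneg l1_dist_nonneg[of I "x 0" "y 0"] by simp
    let ?g = "\<lambda>x i s. exp (l * s) * (l * x s i + R s (x s) i)"
    have int: "(\<lambda>s. ?g x i s - ?g y i s) absolutely_integrable_on {0..t}" if "i \<in> I" for i
      using bounded_measurable_on_absolutely_integrable
          [OF integrand_bounded_measurable[OF x that], of 0 t]
        bounded_measurable_on_absolutely_integrable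
          [OF integrand_bounded_measurable[OF y that], of 0 t] t
      by (intro set_integral_diff) auto
    have int_abs: "(\<lambda>s. \<bar>?g x i s - ?g y i s\<bar>) integrable_on {0..t}" if "i \<in> I" for i
      using int[OF that] unfolding absolutely_integrable_on_def by simp
    have comp: "\<bar>picard x t i - picard y t i\<bar>
        \<le> exp (- l * t) * integral {0..t} (\<lambda>s. \<bar>?g x i s - ?g y i s\<bar>)" if "i \<in> I" for i
    proof -
      have "picard x t i - picard y t i = exp (- l * t) * integral {0..t} (\<lambda>s. ?g x i s - ?g y i s)"
        using bounded_measurable_on_integrable[OF integrand_bounded_measurable[OF x that], of 0 t]
          bounded_measurable_on_integrable[OF integrand_bounded_measurable[OF y that], of 0 t] t
        unfolding picard_def by (subst integral_diff) (auto simp: algebra_simps)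
      moreover have "\<bar>integral {0..t} (\<lambda>s. ?g x i s - ?g y i s)\<bar>
          \<le> integral {0..t} (\<lambda>s. \<bar>?g x i s - ?g y i s\<bar>)"
        using integral_norm_bound_integral[OF _ int_abs[OF that], of "\<lambda>s. ?g x i s - ?g y i s"]
          set_lebesgue_integral_eq_integral(1)[OF int[OF that]] by simp
      ultimately show ?thesis by (simp add: abs_mult)
    qed
    have "l1_dist I (picard x t) (picard y t)
      \<le> (\<Sum>i\<in>I. exp (- l * t) * integral {0..t} (\<lambda>s. \<bar>?g x i s - ?g y i s\<bar>))"
      unfolding l1_dist_def by (intro sum_mono comp)
    also have "\<dots> = exp (- l * t) * integral {0..t} (\<lambda>s. \<Sum>i\<in>I. \<bar>?g x i s - ?g y i s\<bar>)"
      using int_abs fin by (simp add: integral_sum sum_distrib_left)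
    also have "\<dots> \<le> exp (- l * t) * integral {0..t} (\<lambda>s. exp (l * t) * (M * D) * exp (2 * M * s))"
    proof (intro mult_left_mono integral_le)
      show "(\<lambda>s. \<Sum>i\<in>I. \<bar>?g x i s - ?g y i s\<bar>) integrable_on {0..t}"
        using int_abs fin by (intro integrable_sum)
      show "(\<lambda>s. exp (l * t) * (M * D) * exp (2 * M * s)) integrable_on {0..t}"
        by (intro integrable_continuous_interval continuous_intros)
      fix s assume s: "s \<in> {0..t}"
      have sT: "s \<in> {0..T}" using s t by simp
      have "(\<Sum>i\<in>I. \<bar>?g x i s - ?g y i s\<bar>)
        \<le> (\<Sum>i\<in>I. exp (l * s) * (l * \<bar>x s i - y s i\<bar> + \<bar>R s (x s) i - R s (y s) i\<bar>))"
      proof (rule sum_mono)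
        fix i
        have "\<bar>?g x i s - ?g y i s\<bar>
          = exp (l * s) * \<bar>l * (x s i - y s i) + (R s (x s) i - R s (y s) i)\<bar>"
          by (simp add: abs_mult_pos' algebra_simps flip: abs_mult)
        also have "\<dots> \<le> exp (l * s) * (\<bar>l * (x s i - y s i)\<bar> + \<bar>R s (x s) i - R s (y s) i\<bar>)"
          by (intro mult_left_mono abs_triangle_ineq) simp
        finally show "\<bar>?g x i s - ?g y i s\<bar>
          \<le> exp (l * s) * (l * \<bar>x s i - y s i\<bar> + \<bar>R s (x s) i - R s (y s) i\<bar>)"
          using h_pos by (simp add: abs_mult)
      qed
      also have "\<dots> = exp (l * s) * (l * l1_dist I (x s) (y s) + l1_dist I (R s (x s)) (R s (y s)))"
        unfolding l1_dist_def by (simp add: sum_distrib_left sum.distrib distrib_left)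
      also have "\<dots> \<le> exp (l * s) * (M * l1_dist I (x s) (y s))"
        using C(2)[OF sT curves_mem[OF x sT] curves_mem[OF y sT]]
        by (simp add: M_def distrib_right)
      \<comment> \<open>Replacing \<open>exp (l * s)\<close> by \<open>exp (l * t)\<close> is crude
        but sufficient: the prefactor \<open>exp (- l * t)\<close> cancels it exactly, and the
        weight alone remains to be integrated.\<close>
      also have "\<dots> \<le> exp (l * t) * (M * (D * exp (2 * M * s)))"
        using s M h_pos D[OF sT] D0
        by (intro mult_mono) (auto simp: divide_right_mono l1_dist_nonneg)
      finally show "(\<Sum>i\<in>I. \<bar>?g x i s - ?g y i s\<bar>) \<le> exp (l * t) * (M * D) * exp (2 * M * s)"
        by (simp add: mult_ac)
    qed simp
    also have "\<dots> = D / 2 * (exp (2 * M * t) - 1)"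
      using integral_exp[of t "2 * M"] t M by (simp flip: mult.assoc exp_add)
    also have "\<dots> \<le> D / 2 * exp (2 * M * t)"
      using D0 by (intro mult_left_mono) auto
    finally show "l1_dist I (picard x t) (picard y t) \<le> D / 2 * exp (2 * M * t)" .
  qed
qed

section \<open>The Picard iteration and its limit\<close>

definition iterate :: "nat \<Rightarrow> real \<Rightarrow> 'i \<Rightarrow> real" where
  "iterate k = (picard ^^ k) (\<lambda>_. \<phi>)"

lemma iterate_Suc: "iterate (Suc k) = picard (iterate k)"
  unfolding iterate_def by simp

lemma iterate_0: "iterate 0 = (\<lambda>_. \<phi>)"
  unfolding iterate_def by simp

lemma iterate_curves: "iterate k \<in> curves T I K"
  by (induction k)
    (use init in \<open>auto simp: iterate_Suc intro: picard_curves\<close>, simp add: iterate_def curves_def)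

lemma iterate_uniform_limit:
  obtains y where "\<And>i. i \<in> I \<Longrightarrow>
    uniform_limit {0..T} (\<lambda>k t. iterate k t i) (\<lambda>t. y t i) sequentially"
proof -
  obtain M where M: "0 < M"
    "\<And>x y D t. x \<in> curves T I K \<Longrightarrow> y \<in> curves T I K \<Longrightarrow>
       (\<And>t. t \<in> {0..T} \<Longrightarrow> l1_dist I (x t) (y t) \<le> D * exp (2 * M * t)) \<Longrightarrow>
       t \<in> {0..T} \<Longrightarrow> l1_dist I (picard x t) (picard y t) \<le> D / 2 * exp (2 * M * t)"
    using picard_contraction by metis
  have "continuous_on {0..T} (\<lambda>t. l1_dist I (iterate 1 t) (iterate 0 t))"
    unfolding l1_dist_def
    by (intro continuous_intros curves_continuous[OF iterate_curves])
  then have "bounded ((\<lambda>t. l1_dist I (iterate 1 t) (iterate 0 t)) ` {0..T})"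
    by (intro compact_imp_bounded compact_continuous_image) auto
  then obtain D where "\<forall>d\<in>(\<lambda>t. l1_dist I (iterate 1 t) (iterate 0 t)) ` {0..T}. norm d \<le> D"
    unfolding bounded_iff by blast
  then have D: "l1_dist I (iterate 1 t) (iterate 0 t) \<le> D" if "t \<in> {0..T}" for t
    using that l1_dist_nonneg[of I] by auto
  have D0: "0 \<le> D"
    using D[of 0] T_nonneg l1_dist_nonneg[of I "iterate 1 0" "iterate 0 0"] by simp
  have step: "l1_dist I (iterate (Suc k) t) (iterate k t) \<le> D / 2 ^ k * exp (2 * M * t)"
    if "t \<in> {0..T}" for k t
    using that
  proof (induction k arbitrary: t)
    case 0
    have "D * 1 \<le> D * exp (2 * M * t)"
      using D0 M(1) 0 by (intro mult_left_mono) auto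
    then show ?case using D[OF 0] by simp
  next
    case (Suc k)
    have "l1_dist I (picard (iterate (Suc k)) t) (picard (iterate k) t)
        \<le> D / 2 ^ k / 2 * exp (2 * M * t)"
      by (rule M(2)[OF iterate_curves iterate_curves Suc.IH Suc.prems])
    then show ?case by (simp add: iterate_Suc mult.commute)
  qed
  \<comment> \<open>Writing the limit as a telescoping series lets the Weierstrass test give
    existence and uniform convergence together. The weight is at most
    \<open>exp (2 * M * T)\<close>, so a geometric series dominates.\<close>
  define y where "y t i = \<phi> i + (\<Sum>k. iterate (Suc k) t i - iterate k t i)" for t i
  show ?thesis
  proof
    fix i assume i: "i \<in> I"
    have "uniform_limit {0..T} (\<lambda>n t. \<Sum>k<n. iterate (Suc k) t i - iterate k t i)
      (\<lambda>t. \<Sum>k. iterate (Suc k) t i - iterate k t i) sequentially"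
    proof (rule Weierstrass_m_test)
      show "summable (\<lambda>k. D * exp (2 * M * T) * (1 / 2) ^ k)"
        by (intro summable_mult summable_geometric) simp
      fix k t assume t: "t \<in> {0..T}"
      have "\<bar>iterate (Suc k) t i - iterate k t i\<bar> \<le> D / 2 ^ k * exp (2 * M * t)"
        using l1_dist_component[OF fin i] step[OF t] by (rule order_trans)
      also have "\<dots> \<le> D / 2 ^ k * exp (2 * M * T)"
        using t M(1) D0 by (intro mult_left_mono) auto
      finally show "norm (iterate (Suc k) t i - iterate k t i) \<le> D * exp (2 * M * T) * (1 / 2) ^ k"
        by (simp add: power_one_over field_simps)
    qed
    then have "uniform_limit {0..T}
      (\<lambda>n t. \<phi> i + (\<Sum>k<n. iterate (Suc k) t i - iterate k t i)) (\<lambda>t. y t i) sequentially"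
      unfolding y_def by (intro uniform_limit_intros)
    moreover have "\<phi> i + (\<Sum>k<n. iterate (Suc k) t i - iterate k t i) = iterate n t i" for n t
      using sum_lessThan_telescope[of "\<lambda>k. iterate k t i" n] by (simp add: iterate_0)
    ultimately show "uniform_limit {0..T} (\<lambda>k t. iterate k t i) (\<lambda>t. y t i) sequentially"
      by simp
  qed
qed

text \<open>The iterates converge to \<open>y\<close> uniformly, hence within any \<open>D\<close>
  in the weighted sense; the contraction carries this over to their images. The shifted sequence
  thus has both \<open>y\<close> and \<open>picard y\<close> as its limit.\<close>

lemma picard_fixed_point:
  obtains y where "y \<in> curves T I K"
    "\<And>t i. t \<in> {0..T} \<Longrightarrow> i \<in> I \<Longrightarrow> y t i = picard y t i"
proof -
  obtain y where y: "\<And>i. i \<in> I \<Longrightarrow>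
    uniform_limit {0..T} (\<lambda>k t. iterate k t i) (\<lambda>t. y t i) sequentially"
    using iterate_uniform_limit by blast
  have lim: "(\<lambda>k. iterate k t i) \<longlonglongrightarrow> y t i" if "t \<in> {0..T}" "i \<in> I" for t i
    using tendsto_uniform_limitI[OF y] that by blast
  have "continuous_on {0..T} (\<lambda>t. y t i)" if "i \<in> I" for i
    by (rule uniform_limit_theorem[OF _ y[OF that]])
      (auto intro!: always_eventually curves_continuous[OF iterate_curves that])
  moreover have "y t \<in> K" if t: "t \<in> {0..T}" for t
  proof -
    have "(\<Sum>i\<in>I. a i * y t i) \<le> b" if ab: "(a, b) \<in> P" for a b
    proof (rule LIMSEQ_le_const2)
      show "(\<lambda>k. \<Sum>i\<in>I. a i * iterate k t i) \<longlonglongrightarrow> (\<Sum>i\<in>I. a i * y t i)"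
        by (intro tendsto_intros lim[OF t])
      show "\<exists>N. \<forall>k\<ge>N. (\<Sum>i\<in>I. a i * iterate k t i) \<le> b"
        using half_spaces_le[OF curves_mem[OF iterate_curves t] ab] by blast
    qed
    then show ?thesis unfolding half_spaces_def by blast
  qed
  ultimately have yc: "y \<in> curves T I K"
    unfolding curves_def by blast
  obtain M where M: "0 < M"
    "\<And>x y D t. x \<in> curves T I K \<Longrightarrow> y \<in> curves T I K \<Longrightarrow>
       (\<And>t. t \<in> {0..T} \<Longrightarrow> l1_dist I (x t) (y t) \<le> D * exp (2 * M * t)) \<Longrightarrow>
       t \<in> {0..T} \<Longrightarrow> l1_dist I (picard x t) (picard y t) \<le> D / 2 * exp (2 * M * t)"
    using picard_contraction by metis
  have "y t i = picard y t i" if t: "t \<in> {0..T}" and i: "i \<in> I" for t i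
  proof (rule LIMSEQ_unique)
    show "(\<lambda>k. iterate (Suc k) t i) \<longlonglongrightarrow> y t i"
      using lim[OF t i] by (rule LIMSEQ_Suc)
    have "uniform_limit {0..T} (\<lambda>k t. l1_dist I (iterate k t) (y t)) (\<lambda>t. \<Sum>i\<in>I. 0) sequentially"
      unfolding l1_dist_def
    proof (rule uniform_limit_sum)
      fix i assume "i \<in> I"
      from y[OF this] show "uniform_limit {0..T} (\<lambda>k t. \<bar>iterate k t i - y t i\<bar>) (\<lambda>t. 0) sequentially"
        by (simp add: uniform_limit_iff dist_real_def)
    qed
    then have u: "uniform_limit {0..T} (\<lambda>k t. l1_dist I (iterate k t) (y t)) (\<lambda>t. 0) sequentially"
      by simp
    show "(\<lambda>k. iterate (Suc k) t i) \<longlonglongrightarrow> picard y t i"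
    proof (rule tendstoI)
      fix e :: real assume e: "0 < e"
      \<comment> \<open>The time \<open>t\<close> is fixed here, and \<open>D\<close> is chosen so
        that the contraction bound at \<open>t\<close> equals \<open>e / 2\<close>.\<close>
      define D where "D = e / exp (2 * M * t)"
      have D: "0 < D" using e by (simp add: D_def)
      from u D have "\<forall>\<^sub>F k in sequentially. \<forall>t\<in>{0..T}. dist (l1_dist I (iterate k t) (y t)) 0 < D"
        unfolding uniform_limit_iff by blast
      then show "\<forall>\<^sub>F k in sequentially. dist (iterate (Suc k) t i) (picard y t i) < e"
      proof (rule eventually_mono)
        fix k assume k: "\<forall>t\<in>{0..T}. dist (l1_dist I (iterate k t) (y t)) 0 < D"
        have "l1_dist I (iterate k s) (y s) \<le> D * exp (2 * M * s)" if s: "s \<in> {0..T}" for s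
        proof -
          have "l1_dist I (iterate k s) (y s) \<le> D * 1"
            using k s by fastforce
          also have "\<dots> \<le> D * exp (2 * M * s)"
            using D M(1) s by (intro mult_left_mono) auto
          finally show ?thesis .
        qed
        then have "l1_dist I (iterate (Suc k) t) (picard y t) \<le> D / 2 * exp (2 * M * t)"
          unfolding iterate_Suc by (rule M(2)[OF iterate_curves yc _ t])
        also have "\<dots> < e" using e by (simp add: D_def)
        finally show "dist (iterate (Suc k) t i) (picard y t i) < e"
          using l1_dist_component[OF fin i, of "iterate (Suc k) t" "picard y t"]
          by (simp add: dist_real_def)
      qed
    qed
  qed
  with yc show ?thesis by (rule that)
qed

theorem viable_solution:
  obtains y where "y \<in> curves T I K"
    "\<And>t i. t \<in> {0..T} \<Longrightarrow> i \<in> I \<Longrightarrow> y t i = \<phi> i + integral {0..t} (\<lambda>s. R s (y s) i)"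
proof -
  obtain y where y: "y \<in> curves T I K"
    "\<And>t i. t \<in> {0..T} \<Longrightarrow> i \<in> I \<Longrightarrow> y t i = picard y t i"
    using picard_fixed_point by blast
  have "y t i = \<phi> i + integral {0..t} (\<lambda>s. R s (y s) i)" if "t \<in> {0..T}" "i \<in> I" for t i
    using y that unfolding picard_def
    by (intro exponential_weight_fixed_point[where l = l])
      (auto intro: admissible_along_curve[OF adm] curves_continuous)
  with y(1) show ?thesis by (rule that)
qed

end

section \<open>Admissible right-hand sides\<close>

lemma admissibleI:
  assumes "\<And>t x. t \<in> {0..T} \<Longrightarrow> x \<in> K \<Longrightarrow> \<bar>f t x\<bar> \<le> B" and "0 \<le> C"
    and "\<And>t x y. t \<in> {0..T} \<Longrightarrow> x \<in> K \<Longrightarrow> y \<in> K \<Longrightarrow> \<bar>f t x - f t y\<bar> \<le> C * l1_dist I x y"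
    and "\<And>x. x \<in> curves T I K \<Longrightarrow> (\<lambda>t. f t (x t)) \<in> borel_measurable (lebesgue_on {0..T})"
  shows "admissible T I K f"
  using assms unfolding admissible_def by blast

lemma admissibleE:
  assumes "admissible T I K f"
  obtains B C where "0 \<le> B" "0 \<le> C"
    and "\<And>t x. t \<in> {0..T} \<Longrightarrow> x \<in> K \<Longrightarrow> \<bar>f t x\<bar> \<le> B"
    and "\<And>t x y. t \<in> {0..T} \<Longrightarrow> x \<in> K \<Longrightarrow> y \<in> K \<Longrightarrow> \<bar>f t x - f t y\<bar> \<le> C * l1_dist I x y"
    and "\<And>x. x \<in> curves T I K \<Longrightarrow> (\<lambda>t. f t (x t)) \<in> borel_measurable (lebesgue_on {0..T})"
proof -
  obtain B C where BC: "\<forall>t\<in>{0..T}. \<forall>x\<in>K. \<bar>f t x\<bar> \<le> B" "0 \<le> C"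
    "\<forall>t\<in>{0..T}. \<forall>x\<in>K. \<forall>y\<in>K. \<bar>f t x - f t y\<bar> \<le> C * l1_dist I x y"
    using assms unfolding admissible_def by blast
  show ?thesis
  proof (rule that[of "\<bar>B\<bar>" C])
    show "\<bar>f t x\<bar> \<le> \<bar>B\<bar>" if "t \<in> {0..T}" "x \<in> K" for t x
      using BC(1) that by fastforce
  qed (use assms BC in \<open>auto simp: admissible_def\<close>)
qed

lemma admissible_time:
  assumes "bounded_measurable_on T g"
  shows "admissible T I K (\<lambda>t x. g t)"
proof -
  obtain B where "\<forall>t\<in>{0..T}. \<bar>g t\<bar> \<le> B" "g \<in> borel_measurable (lebesgue_on {0..T})"
    using assms unfolding bounded_measurable_on_def by blast
  then show ?thesis
    by (intro admissibleI[where B = B and C = 0]) auto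
qed

lemma admissible_const: "admissible T I K (\<lambda>t x. c)"
  by (intro admissible_time bounded_measurable_on_continuous continuous_intros)

lemma admissible_component:
  assumes "finite I" "i \<in> I" "\<And>x. x \<in> K \<Longrightarrow> \<bar>x i\<bar> \<le> B"
  shows "admissible T I K (\<lambda>t x. x i)"
proof (rule admissibleI[where B = B and C = 1])
  show "\<bar>x i - y i\<bar> \<le> 1 * l1_dist I x y" for x y
    using l1_dist_component[OF assms(1,2)] by simp
  show "(\<lambda>t. x t i) \<in> borel_measurable (lebesgue_on {0..T})" if "x \<in> curves T I K" for x
    using bounded_measurable_on_continuous[OF curves_continuous[OF that assms(2)]]
    unfolding bounded_measurable_on_def by blast
qed (use assms in auto)

lemma admissible_add:
  assumes f: "admissible T I K f" and g: "admissible T I K g"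
  shows "admissible T I K (\<lambda>t x. f t x + g t x)"
proof (rule admissibleE[OF f], rule admissibleE[OF g])
  fix B C B' C'
  assume nn: "0 \<le> C" "0 \<le> C'"
    and b: "\<And>t x. t \<in> {0..T} \<Longrightarrow> x \<in> K \<Longrightarrow> \<bar>f t x\<bar> \<le> B"
      "\<And>t x. t \<in> {0..T} \<Longrightarrow> x \<in> K \<Longrightarrow> \<bar>g t x\<bar> \<le> B'"
    and lip: "\<And>t x y. t \<in> {0..T} \<Longrightarrow> x \<in> K \<Longrightarrow> y \<in> K \<Longrightarrow> \<bar>f t x - f t y\<bar> \<le> C * l1_dist I x y"
      "\<And>t x y. t \<in> {0..T} \<Longrightarrow> x \<in> K \<Longrightarrow> y \<in> K \<Longrightarrow> \<bar>g t x - g t y\<bar> \<le> C' * l1_dist I x y"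
    and m: "\<And>x. x \<in> curves T I K \<Longrightarrow> (\<lambda>t. f t (x t)) \<in> borel_measurable (lebesgue_on {0..T})"
      "\<And>x. x \<in> curves T I K \<Longrightarrow> (\<lambda>t. g t (x t)) \<in> borel_measurable (lebesgue_on {0..T})"
  show ?thesis
  proof (rule admissibleI[where B = "B + B'" and C = "C + C'"])
    fix t x y assume t: "t \<in> {0..T}" and x: "x \<in> K"
    show "\<bar>f t x + g t x\<bar> \<le> B + B'"
      using b(1)[OF t x] b(2)[OF t x] by linarith
    assume y: "y \<in> K"
    show "\<bar>f t x + g t x - (f t y + g t y)\<bar> \<le> (C + C') * l1_dist I x y"
      using lip(1)[OF t x y] lip(2)[OF t x y] unfolding distrib_right by linarith
  qed (use nn m in auto)
qed

lemma admissible_mult: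
  assumes f: "admissible T I K f" and g: "admissible T I K g"
  shows "admissible T I K (\<lambda>t x. f t x * g t x)"
proof (rule admissibleE[OF f], rule admissibleE[OF g])
  fix B C B' C'
  assume nn: "0 \<le> B" "0 \<le> B'" "0 \<le> C" "0 \<le> C'"
    and b: "\<And>t x. t \<in> {0..T} \<Longrightarrow> x \<in> K \<Longrightarrow> \<bar>f t x\<bar> \<le> B"
      "\<And>t x. t \<in> {0..T} \<Longrightarrow> x \<in> K \<Longrightarrow> \<bar>g t x\<bar> \<le> B'"
    and lip: "\<And>t x y. t \<in> {0..T} \<Longrightarrow> x \<in> K \<Longrightarrow> y \<in> K \<Longrightarrow> \<bar>f t x - f t y\<bar> \<le> C * l1_dist I x y"
      "\<And>t x y. t \<in> {0..T} \<Longrightarrow> x \<in> K \<Longrightarrow> y \<in> K \<Longrightarrow> \<bar>g t x - g t y\<bar> \<le> C' * l1_dist I x y"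
    and m: "\<And>x. x \<in> curves T I K \<Longrightarrow> (\<lambda>t. f t (x t)) \<in> borel_measurable (lebesgue_on {0..T})"
      "\<And>x. x \<in> curves T I K \<Longrightarrow> (\<lambda>t. g t (x t)) \<in> borel_measurable (lebesgue_on {0..T})"
  show ?thesis
  proof (rule admissibleI[where B = "B * B'" and C = "B * C' + C * B'"])
    fix t x y assume t: "t \<in> {0..T}" and x: "x \<in> K"
    show "\<bar>f t x * g t x\<bar> \<le> B * B'"
      using b(1)[OF t x] b(2)[OF t x] nn unfolding abs_mult by (intro mult_mono) auto
    assume y: "y \<in> K"
    have "\<bar>f t x * g t x - f t y * g t y\<bar> = \<bar>f t x * (g t x - g t y) + (f t x - f t y) * g t y\<bar>"
      by (simp add: algebra_simps)
    also have "\<dots> \<le> \<bar>f t x\<bar> * \<bar>g t x - g t y\<bar> + \<bar>f t x - f t y\<bar> * \<bar>g t y\<bar>"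
      by (metis abs_mult abs_triangle_ineq)
    also have "\<dots> \<le> B * (C' * l1_dist I x y) + (C * l1_dist I x y) * B'"
      using b(1)[OF t x] b(2)[OF t y] lip(1)[OF t x y] lip(2)[OF t x y] nn l1_dist_nonneg[of I x y]
      by (intro add_mono mult_mono) auto
    finally show "\<bar>f t x * g t x - f t y * g t y\<bar> \<le> (B * C' + C * B') * l1_dist I x y"
      by (simp add: algebra_simps)
  qed (use nn m in auto)
qed

lemma admissible_diff:
  assumes "admissible T I K f" "admissible T I K g"
  shows "admissible T I K (\<lambda>t x. f t x - g t x)"
  using admissible_add[OF assms(1) admissible_mult[OF admissible_const[of _ _ _ "-1"] assms(2)]]
  by simp

lemma admissible_sum:
  assumes "\<And>j. j \<in> J \<Longrightarrow> admissible T I K (f j)"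
  shows "admissible T I K (\<lambda>t x. \<Sum>j\<in>J. f j t x)"
  using assms
  by (induction J rule: infinite_finite_induct) (auto intro: admissible_const admissible_add)

text \<open>The function \<open>g\<close> is controlled only on \<open>S1 \<times> S2\<close>, like
  a flux limiter on the unit square. It is Lipschitz and hence continuous there, so measurability is
  obtained in the Borel space restricted to that set, into which the inner functions map.\<close>

lemma admissible_compose2:
  fixes g :: "real \<Rightarrow> real \<Rightarrow> real"
  assumes f1: "admissible T I K f1" and f2: "admissible T I K f2"
    and range: "\<And>t x. t \<in> {0..T} \<Longrightarrow> x \<in> K \<Longrightarrow> f1 t x \<in> S1"
      "\<And>t x. t \<in> {0..T} \<Longrightarrow> x \<in> K \<Longrightarrow> f2 t x \<in> S2"
    and bd: "\<And>a b. a \<in> S1 \<Longrightarrow> b \<in> S2 \<Longrightarrow> \<bar>g a b\<bar> \<le> B"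
    and C: "0 \<le> C"
    and lip: "\<And>a b a' b'. a \<in> S1 \<Longrightarrow> b \<in> S2 \<Longrightarrow> a' \<in> S1 \<Longrightarrow> b' \<in> S2 \<Longrightarrow>
      \<bar>g a b - g a' b'\<bar> \<le> C * (\<bar>a - a'\<bar> + \<bar>b - b'\<bar>)"
  shows "admissible T I K (\<lambda>t x. g (f1 t x) (f2 t x))"
proof (rule admissibleE[OF f1], rule admissibleE[OF f2])
  fix C1 C2
  assume nn: "0 \<le> C1" "0 \<le> C2"
    and lip': "\<And>t x y. t \<in> {0..T} \<Longrightarrow> x \<in> K \<Longrightarrow> y \<in> K \<Longrightarrow> \<bar>f1 t x - f1 t y\<bar> \<le> C1 * l1_dist I x y"
      "\<And>t x y. t \<in> {0..T} \<Longrightarrow> x \<in> K \<Longrightarrow> y \<in> K \<Longrightarrow> \<bar>f2 t x - f2 t y\<bar> \<le> C2 * l1_dist I x y"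
    and m: "\<And>x. x \<in> curves T I K \<Longrightarrow> (\<lambda>t. f1 t (x t)) \<in> borel_measurable (lebesgue_on {0..T})"
      "\<And>x. x \<in> curves T I K \<Longrightarrow> (\<lambda>t. f2 t (x t)) \<in> borel_measurable (lebesgue_on {0..T})"
  show ?thesis
  proof (rule admissibleI[where B = B and C = "C * (C1 + C2)"])
    fix t x y assume t: "t \<in> {0..T}" and x: "x \<in> K"
    show "\<bar>g (f1 t x) (f2 t x)\<bar> \<le> B"
      using bd range t x by blast
    assume y: "y \<in> K"
    have "\<bar>g (f1 t x) (f2 t x) - g (f1 t y) (f2 t y)\<bar>
      \<le> C * (\<bar>f1 t x - f1 t y\<bar> + \<bar>f2 t x - f2 t y\<bar>)"
      by (intro lip range t x y)
    also have "\<dots> \<le> C * (C1 * l1_dist I x y + C2 * l1_dist I x y)"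
      by (intro mult_left_mono add_mono lip' t x y C)
    finally show "\<bar>g (f1 t x) (f2 t x) - g (f1 t y) (f2 t y)\<bar> \<le> C * (C1 + C2) * l1_dist I x y"
      by (simp add: algebra_simps)
  next
    fix x assume x: "x \<in> curves T I K"
    \<comment> \<open>The factor 2 arises because each coordinate distance is at most the distance
      in the product.\<close>
    have "(2 * C)-lipschitz_on (S1 \<times> S2) (\<lambda>z. g (fst z) (snd z))"
    proof (rule lipschitz_onI)
      fix z z' assume z: "z \<in> S1 \<times> S2" "z' \<in> S1 \<times> S2"
      have "\<bar>fst z - fst z'\<bar> + \<bar>snd z - snd z'\<bar> \<le> 2 * dist z z'"
        using dist_fst_le[of z z'] dist_snd_le[of z z'] by (simp add: dist_real_def)
      then have "C * (\<bar>fst z - fst z'\<bar> + \<bar>snd z - snd z'\<bar>) \<le> C * (2 * dist z z')"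
        using C by (rule mult_left_mono)
      moreover have "\<bar>g (fst z) (snd z) - g (fst z') (snd z')\<bar>
          \<le> C * (\<bar>fst z - fst z'\<bar> + \<bar>snd z - snd z'\<bar>)"
        using z by (intro lip) auto
      ultimately show "dist (g (fst z) (snd z)) (g (fst z') (snd z')) \<le> 2 * C * dist z z'"
        by (simp add: dist_real_def)
    qed (use C in simp)
    then have "(\<lambda>z. g (fst z) (snd z)) \<in> borel_measurable (restrict_space borel (S1 \<times> S2))"
      by (intro borel_measurable_continuous_on_restrict lipschitz_on_continuous_on)
    moreover have "(\<lambda>t. (f1 t (x t), f2 t (x t)))
        \<in> measurable (lebesgue_on {0..T}) (restrict_space borel (S1 \<times> S2))"
      using range curves_mem[OF x]
      by (intro measurable_restrict_space2 borel_measurable_Pair m x) auto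
    ultimately have "(\<lambda>t. (\<lambda>z. g (fst z) (snd z)) (f1 t (x t), f2 t (x t)))
        \<in> borel_measurable (lebesgue_on {0..T})"
      by (rule measurable_compose[rotated])
    then show "(\<lambda>t. g (f1 t (x t)) (f2 t (x t))) \<in> borel_measurable (lebesgue_on {0..T})"
      by simp
  qed (use nn C in auto)
qed

lemma admissible_compose:
  fixes g :: "real \<Rightarrow> real"
  assumes "admissible T I K f" "\<And>t x. t \<in> {0..T} \<Longrightarrow> x \<in> K \<Longrightarrow> f t x \<in> S"
    and "\<And>a. a \<in> S \<Longrightarrow> \<bar>g a\<bar> \<le> B" and "C-lipschitz_on S g"
  shows "admissible T I K (\<lambda>t x. g (f t x))"
proof -
  have C: "0 \<le> C"
    by (rule lipschitz_on_nonneg[OF assms(4)])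
  have "\<bar>g a - g a'\<bar> \<le> C * (\<bar>a - a'\<bar> + \<bar>b - b'\<bar>)" if "a \<in> S" "a' \<in> S" for a a' b b'
  proof -
    have "\<bar>g a - g a'\<bar> \<le> C * \<bar>a - a'\<bar>"
      using lipschitz_onD[OF assms(4) that] by (simp add: dist_real_def)
    also have "\<dots> \<le> C * (\<bar>a - a'\<bar> + \<bar>b - b'\<bar>)"
      using C by (intro mult_left_mono) auto
    finally show ?thesis .
  qed
  then show ?thesis
    using admissible_compose2[where g = "\<lambda>a b. g a" and ?S2.0 = UNIV and B = B and C = C,
        OF assms(1) admissible_const[of _ _ _ 0] assms(2) _ assms(3) C]
    by simp
qed

section \<open>One Euler step on a road\<close>

text \<open>In the congested regime this is an axiom of the limiter. If u + w \<le> 1, the bound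
  \<Phi> \<le> 1 already gives \<Phi> u \<le> u \<le> 1 - w, so later estimates need not distinguish
  the regimes.\<close>

lemma limiter_inflow_le:
  assumes "flux_limiter \<Phi>" "u \<in> {0..1}" "w \<in> {0..1}"
  shows "\<Phi> u w * u \<le> 1 - w"
proof (cases "u + w > 1")
  case True
  then show ?thesis using assms unfolding flux_limiter_def by blast
next
  case False
  have "\<Phi> u w * u \<le> 1 * u"
    using assms unfolding flux_limiter_def by (intro mult_right_mono) auto
  with False show ?thesis by simp
qed

lemma table_of_games_le_1:
  assumes "table_of_games n A" "h \<in> {1..n}" "k \<in> {1..n}" "j \<in> {1..n}" "r \<in> {0..1}"
  shows "0 \<le> A h k j r" "A h k j r \<le> 1"
proof -
  have nn: "\<And>j. j \<in> {1..n} \<Longrightarrow> 0 \<le> A h k j r" and s: "(\<Sum>j=1..n. A h k j r) = 1"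
    using assms unfolding table_of_games_def by auto
  show "0 \<le> A h k j r" by (rule nn[OF assms(4)])
  show "A h k j r \<le> 1"
    using member_le_sum[of j "{1..n}" "\<lambda>j. A h k j r"] nn assms(4) s by auto
qed

lemma gain_nonneg:
  assumes "table_of_games n A" "\<eta>0 > 0" "\<And>j. j \<in> {1..n} \<Longrightarrow> 0 \<le> f j" "density n f \<le> 1" "j \<in> {1..n}"
  shows "0 \<le> gain \<eta>0 n A f j"
proof -
  have "0 \<le> density n f" unfolding density_def by (intro sum_nonneg assms)
  then show ?thesis
    unfolding gain_def using assms
    by (intro mult_nonneg_nonneg sum_nonneg table_of_games_le_1[OF assms(1)]) auto
qed

text \<open>Conservation of vehicles under interactions: summing over the outcome \<open>j\<close>
  removes the probabilities, and both sides become \<eta>0 times the cube of the density.\<close>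

lemma sum_gain:
  assumes "table_of_games n A" "density n f \<in> {0..1}"
  shows "(\<Sum>j=1..n. gain \<eta>0 n A f j) = density n f * loss \<eta>0 n f"
proof -
  let ?r = "density n f"
  have "(\<Sum>j=1..n. \<Sum>h=1..n. \<Sum>k=1..n. A h k j ?r * f h * f k)
    = (\<Sum>h=1..n. \<Sum>k=1..n. \<Sum>j=1..n. A h k j ?r * f h * f k)"
    by (subst sum.swap) (intro sum.cong refl sum.swap)
  also have "\<dots> = (\<Sum>h=1..n. \<Sum>k=1..n. (\<Sum>j=1..n. A h k j ?r) * f h * f k)"
    by (simp add: sum_distrib_right)
  also have "\<dots> = (\<Sum>h=1..n. \<Sum>k=1..n. f h * f k)"
    using assms unfolding table_of_games_def by (intro sum.cong) auto
  also have "\<dots> = ?r * ?r"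
    unfolding density_def by (simp add: sum_product)
  finally have s: "(\<Sum>j=1..n. \<Sum>h=1..n. \<Sum>k=1..n. A h k j ?r * f h * f k) = ?r * ?r" .
  have "(\<Sum>j=1..n. gain \<eta>0 n A f j) = \<eta>0 * ?r * (?r * ?r)"
    unfolding s[symmetric] gain_def by (rule sum_distrib_left[symmetric])
  then show ?thesis unfolding loss_def by (simp add: power2_eq_square)
qed

text \<open>The step \<open>1 / (1 + \<eta>0)\<close> preserves nonnegativity because the outgoing rate \<open>v j * out\<close> and the
  loss rate add up to at most \<open>1 + \<eta>0\<close>.\<close>

lemma euler_step_road:
  assumes games: "table_of_games n A" and eta: "\<eta>0 > 0"
    and f: "\<And>j. j \<in> {1..n} \<Longrightarrow> 0 \<le> f j" "density n f \<le> 1"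
    and v: "\<And>j. j \<in> {1..n} \<Longrightarrow> 0 \<le> v j \<and> v j \<le> 1"
    and inn: "\<And>j. j \<in> {1..n} \<Longrightarrow> 0 \<le> inn j" "(\<Sum>j=1..n. v j * inn j) \<le> 1 - density n f"
    and out: "0 \<le> out" "out \<le> 1"
    and h: "h = 1 / (1 + \<eta>0)"
    and y: "\<And>j. y j = f j + h * (v j * (inn j - out * f j) + gain \<eta>0 n A f j - f j * loss \<eta>0 n f)"
  shows "\<And>j. j \<in> {1..n} \<Longrightarrow> 0 \<le> y j" "density n y \<le> 1"
proof -
  have r: "0 \<le> density n f"
    unfolding density_def by (intro sum_nonneg f)
  have h1: "0 < h" "h \<le> 1" and h2: "h * (1 + \<eta>0) = 1"
    using eta by (simp_all add: h)
  show "0 \<le> y j" if j: "j \<in> {1..n}" for j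
  proof -
    have "(density n f)\<^sup>2 \<le> 1"
      using r f(2) by (simp add: power_le_one)
    then have "loss \<eta>0 n f \<le> \<eta>0 * 1"
      unfolding loss_def using eta by (intro mult_left_mono) auto
    moreover have "v j * out \<le> 1 * 1"
      using v[OF j] out by (intro mult_mono) auto
    ultimately have "h * (v j * out + loss \<eta>0 n f) \<le> h * (1 + \<eta>0)"
      using h1 by (intro mult_left_mono) auto
    then have "0 \<le> f j * (1 - h * (v j * out + loss \<eta>0 n f))"
      using h2 f(1)[OF j] by (intro mult_nonneg_nonneg) auto
    moreover have "0 \<le> h * (v j * inn j + gain \<eta>0 n A f j)"
      using gain_nonneg[OF games eta f j] v[OF j] inn(1)[OF j] h1
      by (intro mult_nonneg_nonneg add_nonneg_nonneg) auto
    ultimately show ?thesis unfolding y by (simp add: algebra_simps)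
  qed
  have "density n y = density n f
      + h * ((\<Sum>j=1..n. v j * inn j) - out * (\<Sum>j=1..n. v j * f j)
        + (\<Sum>j=1..n. gain \<eta>0 n A f j) - density n f * loss \<eta>0 n f)"
  proof -
    have "y j = f j + h * (v j * inn j) - h * out * (v j * f j) + h * gain \<eta>0 n A f j
        - h * loss \<eta>0 n f * f j" for j
      unfolding y by (simp add: algebra_simps)
    then have "density n y = density n f + h * (\<Sum>j=1..n. v j * inn j)
        - h * out * (\<Sum>j=1..n. v j * f j) + h * (\<Sum>j=1..n. gain \<eta>0 n A f j)
        - h * loss \<eta>0 n f * density n f"
      by (simp only: density_def[of n y] density_def[of n f] sum.distrib sum_subtractf
          sum_distrib_left)
    then show ?thesis by (simp add: algebra_simps)
  qed
  \<comment> \<open>Gain and loss cancel by \<open>sum_gain\<close>, the outflow can only lower the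
    density, and the inflow is at most the free space. Since \<open>h\<close> is at most 1, the new
    density cannot overshoot 1.\<close>
  also have "\<dots> \<le> density n f + h * (1 - density n f)"
  proof -
    have "0 \<le> out * (\<Sum>j=1..n. v j * f j)"
      using out v f(1) by (intro mult_nonneg_nonneg sum_nonneg) auto
    then show ?thesis
      using inn(2) sum_gain[OF games, of f \<eta>0] r f(2) h1 by (intro add_mono mult_left_mono) auto
  qed
  also have "\<dots> \<le> density n f + 1 * (1 - density n f)"
    using h1 f(2) by (intro add_mono mult_right_mono) auto
  finally show "density n y \<le> 1" by simp
qed

section \<open>The 2-1 junction\<close>

definition road :: "nat \<Rightarrow> (nat \<times> nat \<Rightarrow> real) \<Rightarrow> nat \<Rightarrow> real" where
  "road r x = (\<lambda>j. x (r, j))"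

definition junction_index :: "nat \<Rightarrow> (nat \<times> nat) set" where
  "junction_index n = {1, 2, 3} \<times> {1..n}"

text \<open>The three roads form one state indexed by road and speed class. The first family encodes
  nonnegativity of each component, the second the density bound of each road; together they imply
  that components are at most 1.\<close>

definition junction_constraints :: "nat \<Rightarrow> ((nat \<times> nat \<Rightarrow> real) \<times> real) set" where
  "junction_constraints n =
     (\<lambda>i. (\<lambda>k. - of_bool (k = i), 0)) ` junction_index n \<union>
     (\<lambda>r. (\<lambda>k. of_bool (fst k = r), 1)) ` {1, 2, 3}"

abbreviation junction_states :: "nat \<Rightarrow> (nat \<times> nat \<Rightarrow> real) set" where
  "junction_states n \<equiv> half_spaces (junction_index n) (junction_constraints n)"

lemma finite_junction_index: "finite (junction_index n)"
  unfolding junction_index_def by simp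

lemma junction_states_iff:
  "x \<in> junction_states n \<longleftrightarrow>
     (\<forall>r\<in>{1, 2, 3}. (\<forall>j\<in>{1..n}. 0 \<le> road r x j) \<and> density n (road r x) \<le> 1)"
proof -
  have pos: "(\<Sum>k\<in>junction_index n. - of_bool (k = i) * x k) = - x i" if "i \<in> junction_index n" for i
  proof -
    have "(\<Sum>k\<in>junction_index n. - of_bool (k = i) * x k)
      = (\<Sum>k\<in>junction_index n. if k = i then - x k else 0)"
      by (intro sum.cong) auto
    then show ?thesis using that finite_junction_index by (simp add: sum.delta)
  qed
  have dens: "(\<Sum>k\<in>junction_index n. of_bool (fst k = r) * x k) = density n (road r x)"
    if "r \<in> {1, 2, 3}" for r
  proof -
    have "(\<Sum>k\<in>junction_index n. of_bool (fst k = r) * x k)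
      = (\<Sum>q\<in>{1, 2, 3}. \<Sum>j=1..n. of_bool (q = r) * x (q, j))"
      unfolding junction_index_def by (simp add: sum.cartesian_product' del: sum.insert)
    also have "\<dots> = (\<Sum>q\<in>{1, 2, 3}. if q = r then density n (road q x) else 0)"
      unfolding density_def road_def by (intro sum.cong) auto
    also have "\<dots> = density n (road r x)"
      using that by (subst sum.delta) auto
    finally show ?thesis .
  qed
  have "x \<in> junction_states n \<longleftrightarrow>
      (\<forall>i\<in>junction_index n. (\<Sum>k\<in>junction_index n. - of_bool (k = i) * x k) \<le> 0) \<and>
      (\<forall>r\<in>{1, 2, 3}. (\<Sum>k\<in>junction_index n. of_bool (fst k = r) * x k) \<le> 1)"
    unfolding half_spaces_def junction_constraints_def by (auto simp: ball_Un)
  also have "\<dots> \<longleftrightarrow> (\<forall>i\<in>junction_index n. 0 \<le> x i) \<and> (\<forall>r\<in>{1, 2, 3}. density n (road r x) \<le> 1)"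
    using pos dens by simp
  also have "\<dots> \<longleftrightarrow> (\<forall>r\<in>{1, 2, 3}. (\<forall>j\<in>{1..n}. 0 \<le> road r x j) \<and> density n (road r x) \<le> 1)"
    unfolding junction_index_def road_def by auto
  finally show ?thesis .
qed

locale junction_21 =
  fixes T p \<eta>0 \<epsilon> :: real and n :: nat
    and v :: "nat \<Rightarrow> real" and H :: "real \<Rightarrow> real"
    and A :: "nat \<Rightarrow> nat \<Rightarrow> nat \<Rightarrow> real \<Rightarrow> real"
    and \<Phi> :: "real \<Rightarrow> real \<Rightarrow> real"
    and fb1 fb2 :: "real \<Rightarrow> nat \<Rightarrow> real"
    and Pb3 :: "real \<Rightarrow> real"
  assumes T_pos: "T > 0" and n_ge_2: "n \<ge> 2" and speeds: "speeds n v"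
    and p_le: "p \<le> v 2" and eta: "\<eta>0 > 0"
    and heaviside: "regularized_heaviside \<epsilon> H"
    and games: "table_of_games n A"
    and limiter: "flux_limiter \<Phi>"
    and fb1: "fb1 \<in> B_set T n" and fb2: "fb2 \<in> B_set T n"
    and Pb3_measurable: "Pb3 \<in> borel_measurable (lebesgue_on {0..T})"
    and Pb3_range: "\<And>t. t \<in> {0..T} \<Longrightarrow> 0 \<le> Pb3 t \<and> Pb3 t \<le> 1"
begin

abbreviation states where "states \<equiv> junction_states n"

abbreviation Adm where "Adm \<equiv> admissible T (junction_index n) states"

definition acc :: "(nat \<times> nat \<Rightarrow> real) \<Rightarrow> real" where
  "acc x = access n v p H (road 1 x) (road 2 x)"

definition limiter_value :: "(nat \<times> nat \<Rightarrow> real) \<Rightarrow> real" where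
  "limiter_value x = junction_limiter n v p H \<Phi> (road 1 x) (road 2 x) (road 3 x)"

text \<open>Together with \<open>outflow\<close>, this brings the three equations to the common form
  \<open>v j * (inn j - out * f j)\<close> of \<open>euler_step_road\<close>. The limiters at the
  entrances of roads 1 and 2 depend on the solution, so they are evaluated at the state
  \<open>x\<close>.\<close>

definition inflow :: "real \<Rightarrow> (nat \<times> nat \<Rightarrow> real) \<Rightarrow> nat \<times> nat \<Rightarrow> real" where
  "inflow s x = (\<lambda>(r, j).
     if r = 1 then \<Phi> (density n (fb1 s)) (density n (road 1 x)) * fb1 s j
     else if r = 2 then \<Phi> (density n (fb2 s)) (density n (road 2 x)) * fb2 s j
     else limiter_value x * (road 1 x j + acc x * road 2 x j) * delta_c j)"

definition outflow :: "real \<Rightarrow> (nat \<times> nat \<Rightarrow> real) \<Rightarrow> nat \<Rightarrow> real" where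
  "outflow s x r = (if r = 1 then limiter_value x else if r = 2 then acc x * limiter_value x else Pb3 s)"

definition field :: "real \<Rightarrow> (nat \<times> nat \<Rightarrow> real) \<Rightarrow> nat \<times> nat \<Rightarrow> real" where
  "field s x = (\<lambda>(r, j). v j * (inflow s x (r, j) - outflow s x r * road r x j)
     + gain \<eta>0 n A (road r x) j - road r x j * loss \<eta>0 n (road r x))"

section \<open>Ranges of the coefficients and invariance of the admissible states\<close>

lemma v_range: "0 \<le> v j \<and> v j \<le> 1" if "j \<in> {1..n}"
proof -
  have m: "mono_on {1..n} v"
    using speeds strict_mono_on_imp_mono_on unfolding speeds_def by blast
  show ?thesis
    using mono_onD[OF m, of 1 j] mono_onD[OF m, of j n] that speeds unfolding speeds_def by auto
qed

lemma v2_le: "v 2 \<le> v j" if "j \<in> {2..n}"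
  using speeds strict_mono_on_leD[of "{1..n}" v 2 j] that unfolding speeds_def by auto

lemma v2_pos: "0 < v 2"
  using speeds strict_mono_onD[of "{1..n}" v 1 2] n_ge_2 unfolding speeds_def by auto

lemma H_range: "0 \<le> H x \<and> H x \<le> 1"
  using heaviside unfolding regularized_heaviside_def
  by (metis order_refl not_le zero_le_one)

lemma states_nonneg: "x \<in> states \<Longrightarrow> r \<in> {1, 2, 3} \<Longrightarrow> j \<in> {1..n} \<Longrightarrow> 0 \<le> road r x j"
  and states_density: "x \<in> states \<Longrightarrow> r \<in> {1, 2, 3} \<Longrightarrow> density n (road r x) \<in> {0..1}"
  unfolding junction_states_iff density_def by (auto intro!: sum_nonneg)

lemma B_set_nonneg: "u \<in> B_set T n \<Longrightarrow> t \<in> {0..T} \<Longrightarrow> j \<in> {1..n} \<Longrightarrow> 0 \<le> u t j"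
  and B_set_density: "u \<in> B_set T n \<Longrightarrow> t \<in> {0..T} \<Longrightarrow> density n (u t) \<in> {0..1}"
  unfolding B_set_def density_def by (auto intro!: sum_nonneg)

lemma states_le_1: "road r x j \<le> 1" if "x \<in> states" "r \<in> {1, 2, 3}" "j \<in> {1..n}"
  using member_le_sum[of j "{1..n}" "road r x"] states_nonneg[OF that(1,2)]
    states_density[OF that(1,2)] that(3) unfolding density_def by fastforce

lemma acc_range: "0 \<le> acc x \<and> acc x \<le> 1"
  unfolding acc_def access_def by (rule H_range)

text \<open>If road 2 has access, then the total flux is below \<open>p \<le> v 2\<close>, so the moving vehicles of
  both roads together have density below 1.\<close>

lemma inflow_density_range:
  assumes x: "x \<in> states"
  shows "inflow_density n v p H (road 1 x) (road 2 x) \<in> {0..1}"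
proof -
  have nn: "0 \<le> road 1 x j" "0 \<le> road 2 x j" if "j \<in> {1..n}" for j
    using states_nonneg[OF x] that by auto
  have eq: "inflow_density n v p H (road 1 x) (road 2 x)
      = (\<Sum>j=2..n. road 1 x j + acc x * road 2 x j)"
    unfolding inflow_density_def acc_def ..
  have "0 \<le> (\<Sum>j=2..n. road 1 x j + acc x * road 2 x j)"
    using nn acc_range by (intro sum_nonneg add_nonneg_nonneg mult_nonneg_nonneg) auto
  moreover have "(\<Sum>j=2..n. road 1 x j + acc x * road 2 x j) \<le> 1"
  proof (cases "acc x = 0")
    case True
    have "(\<Sum>j=2..n. road 1 x j) \<le> (\<Sum>j=1..n. road 1 x j)"
      using nn by (intro sum_mono2) auto
    also have "\<dots> \<le> 1"
      using states_density[OF x, of 1] unfolding density_def by simp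
    finally show ?thesis using True by simp
  next
    case False
    have "0 < p - (flux n v (road 1 x) + flux n v (road 2 x))"
    proof (rule ccontr)
      assume "\<not> ?thesis"
      then have "acc x = 0"
        using heaviside unfolding acc_def access_def regularized_heaviside_def by auto
      with False show False ..
    qed
    then have "flux n v (road 1 x) + flux n v (road 2 x) \<le> v 2"
      using p_le by simp
    \<comment> \<open>The sum omits the class at rest, and \<open>v 2\<close> is the smallest of the
      remaining speeds, so \<open>v 2\<close> times the moving density is at most the flux.
      Positivity of \<open>v 2\<close> then allows cancelling it.\<close>
    moreover have "v 2 * (\<Sum>j=2..n. road 1 x j + acc x * road 2 x j)
      \<le> flux n v (road 1 x) + flux n v (road 2 x)"
    proof -
      have "v 2 * (\<Sum>j=2..n. road 1 x j + acc x * road 2 x j)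
        \<le> (\<Sum>j=2..n. v j * (road 1 x j + road 2 x j))"
        unfolding sum_distrib_left using nn acc_range v2_pos v2_le
        by (intro sum_mono mult_mono add_mono mult_left_le_one_le add_nonneg_nonneg
            mult_nonneg_nonneg) (auto intro: order_trans[OF less_imp_le[OF v2_pos]])
      also have "\<dots> \<le> (\<Sum>j=1..n. v j * (road 1 x j + road 2 x j))"
        using nn v_range by (intro sum_mono2) auto
      finally show ?thesis
        unfolding flux_def by (simp add: sum.distrib distrib_left)
    qed
    ultimately have "v 2 * (\<Sum>j=2..n. road 1 x j + acc x * road 2 x j) \<le> v 2 * 1"
      by simp
    then show ?thesis using v2_pos by (simp only: mult_le_cancel_left_pos)
  qed
  ultimately show ?thesis unfolding eq by simp
qed

lemma limiter_range: "a \<in> {0..1} \<Longrightarrow> b \<in> {0..1} \<Longrightarrow> 0 \<le> \<Phi> a b \<and> \<Phi> a b \<le> 1"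
  using limiter unfolding flux_limiter_def by blast

lemma limiter_value_range: "x \<in> states \<Longrightarrow> 0 \<le> limiter_value x \<and> limiter_value x \<le> 1"
  unfolding limiter_value_def junction_limiter_def
  by (intro limiter_range inflow_density_range states_density) auto

lemma outflow_range:
  assumes "s \<in> {0..T}" "x \<in> states"
  shows "0 \<le> outflow s x r" "outflow s x r \<le> 1"
  using limiter_value_range[OF assms(2)] acc_range[of x] Pb3_range[OF assms(1)]
  unfolding outflow_def by (auto intro: mult_le_one)

text \<open>Speeds are at most 1, so the incoming flux is at most the limiter times the boundary
  density, which is the product bounded by \<open>limiter_inflow_le\<close>.\<close>

lemma boundary_inflow:
  assumes u: "u \<in> B_set T n" and s: "s \<in> {0..T}" and f: "density n f \<in> {0..1}"
  shows "j \<in> {1..n} \<Longrightarrow> 0 \<le> \<Phi> (density n (u s)) (density n f) * u s j"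
    and "(\<Sum>j=1..n. v j * (\<Phi> (density n (u s)) (density n f) * u s j)) \<le> 1 - density n f"
proof -
  let ?P = "\<Phi> (density n (u s)) (density n f)"
  have P: "0 \<le> ?P"
    using limiter_range[OF B_set_density[OF u s] f] by simp
  then show nn: "0 \<le> ?P * u s j" if "j \<in> {1..n}" for j
    using B_set_nonneg[OF u s that] by simp
  have "(\<Sum>j=1..n. v j * (?P * u s j)) \<le> (\<Sum>j=1..n. ?P * u s j)"
    using nn v_range by (intro sum_mono mult_left_le_one_le) auto
  also have "\<dots> = ?P * density n (u s)"
    unfolding density_def[of n "u s"] by (rule sum_distrib_left[symmetric])
  also have "\<dots> \<le> 1 - density n f"
    by (rule limiter_inflow_le[OF limiter B_set_density[OF u s] f])
  finally show "(\<Sum>j=1..n. v j * (?P * u s j)) \<le> 1 - density n f" .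
qed

lemma inflow_road:
  assumes s: "s \<in> {0..T}" and x: "x \<in> states" and r: "r \<in> {1, 2, 3}"
  shows "j \<in> {1..n} \<Longrightarrow> 0 \<le> inflow s x (r, j)"
    and "(\<Sum>j=1..n. v j * inflow s x (r, j)) \<le> 1 - density n (road r x)"
proof -
  have nn3: "0 \<le> inflow s x (3, j)" if "j \<in> {1..n}" for j
    using limiter_value_range[OF x] acc_range[of x] states_nonneg[OF x _ that]
    unfolding inflow_def delta_c_def by auto
  have "(\<Sum>j=1..n. v j * inflow s x (3, j)) \<le> (\<Sum>j=1..n. inflow s x (3, j))"
    using nn3 v_range by (intro sum_mono mult_left_le_one_le) auto
  \<comment> \<open>The factor \<open>delta_c\<close> removes class 1. What remains is the limiter
    times its own first argument, so the limiter bound applies to road 3 just as at an outer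
    boundary.\<close>
  also have "\<dots> = (\<Sum>j=2..n. limiter_value x * (road 1 x j + acc x * road 2 x j))"
    by (rule sum.mono_neutral_cong_right) (auto simp: inflow_def delta_c_def)
  also have "\<dots> = limiter_value x * inflow_density n v p H (road 1 x) (road 2 x)"
    unfolding inflow_density_def acc_def by (rule sum_distrib_left[symmetric])
  also have "\<dots> \<le> 1 - density n (road 3 x)"
    unfolding limiter_value_def junction_limiter_def
    by (intro limiter_inflow_le limiter inflow_density_range states_density x) auto
  finally have sum3: "(\<Sum>j=1..n. v j * inflow s x (3, j)) \<le> 1 - density n (road 3 x)" .
  show "0 \<le> inflow s x (r, j)" if "j \<in> {1..n}"
    using boundary_inflow(1)[OF fb1 s states_density[OF x, of 1] that]
      boundary_inflow(1)[OF fb2 s states_density[OF x, of 2] that] nn3[OF that] r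
    by (auto simp: inflow_def)
  show "(\<Sum>j=1..n. v j * inflow s x (r, j)) \<le> 1 - density n (road r x)"
    using boundary_inflow(2)[OF fb1 s states_density[OF x, of 1]]
      boundary_inflow(2)[OF fb2 s states_density[OF x, of 2]] sum3 r
    by (auto simp: inflow_def)
qed

lemma field_subtangential:
  assumes s: "s \<in> {0..T}" and x: "x \<in> states"
  shows "(\<lambda>i. x i + 1 / (1 + \<eta>0) * field s x i) \<in> states"
  unfolding junction_states_iff
proof (intro ballI)
  fix r :: nat assume r: "r \<in> {1, 2, 3}"
  let ?y = "\<lambda>i. x i + 1 / (1 + \<eta>0) * field s x i"
  note step = euler_step_road[where y = "road r ?y", OF games eta states_nonneg[OF x r] _ v_range
      inflow_road[OF s x r] outflow_range[OF s x] refl]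
  have "density n (road r x) \<le> 1"
    using states_density[OF x r] by simp
  then show "(\<forall>j\<in>{1..n}. 0 \<le> road r ?y j) \<and> density n (road r ?y) \<le> 1"
    using step[of r] by (simp add: road_def field_def)
qed

section \<open>Boundedness, Lipschitz continuity and measurability of the junction field\<close>

lemma admissible_road: "Adm (\<lambda>s x. road r x j)" if "r \<in> {1, 2, 3}" "j \<in> {1..n}"
  unfolding road_def
proof (rule admissible_component[where B = 1])
  show "(r, j) \<in> junction_index n"
    using that by (simp add: junction_index_def)
  show "\<bar>x (r, j)\<bar> \<le> 1" if "x \<in> states" for x
    using states_nonneg[OF that \<open>r \<in> _\<close> \<open>j \<in> _\<close>] states_le_1[OF that \<open>r \<in> _\<close> \<open>j \<in> _\<close>]
    by (simp add: road_def)
qed (rule finite_junction_index)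

lemma admissible_density: "Adm (\<lambda>s x. density n (road r x))" if "r \<in> {1, 2, 3}"
  unfolding density_def by (intro admissible_sum admissible_road that)

text \<open>The regularization of the switch is used here: a Heaviside function with a jump would
  make the field discontinuous in the state.\<close>

lemma admissible_acc: "Adm (\<lambda>s x. acc x)"
proof -
  obtain C where "C-lipschitz_on UNIV H"
    using heaviside unfolding regularized_heaviside_def by blast
  then show ?thesis
    unfolding acc_def access_def flux_def using H_range
    by (intro admissible_compose[where g = H and S = UNIV and B = 1] admissible_diff admissible_add
        admissible_sum admissible_mult admissible_const admissible_road) auto
qed

lemma admissible_limiter:
  assumes "Adm f" "Adm g"
    and "\<And>t x. t \<in> {0..T} \<Longrightarrow> x \<in> states \<Longrightarrow> f t x \<in> {0..1}"
    and "\<And>t x. t \<in> {0..T} \<Longrightarrow> x \<in> states \<Longrightarrow> g t x \<in> {0..1}"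
  shows "Adm (\<lambda>t x. \<Phi> (f t x) (g t x))"
proof -
  obtain C where "C > 0"
    "\<forall>u1\<in>{0..1}. \<forall>w1\<in>{0..1}. \<forall>u2\<in>{0..1}. \<forall>w2\<in>{0..1}.
        \<bar>\<Phi> u2 w2 - \<Phi> u1 w1\<bar> \<le> C * (\<bar>u2 - u1\<bar> + \<bar>w2 - w1\<bar>)"
    using limiter unfolding flux_limiter_def by blast
  then show ?thesis
    using limiter_range
    by (intro admissible_compose2[where g = \<Phi> and B = 1 and C = C and ?S1.0 = "{0..1}" and ?S2.0 = "{0..1}"]
        assms) auto
qed

lemma admissible_limiter_value: "Adm (\<lambda>s x. limiter_value x)"
proof -
  have "Adm (\<lambda>s x. \<Sum>j=2..n. road 1 x j + acc x * road 2 x j)"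
    by (intro admissible_sum admissible_add admissible_mult admissible_acc admissible_road) auto
  then have "Adm (\<lambda>s x. inflow_density n v p H (road 1 x) (road 2 x))"
    unfolding inflow_density_def acc_def .
  then show ?thesis
    unfolding limiter_value_def junction_limiter_def
    by (intro admissible_limiter admissible_density inflow_density_range states_density) auto
qed

lemma bounded_measurable_B_set:
  assumes "u \<in> B_set T n" "j \<in> {1..n}"
  shows "bounded_measurable_on T (\<lambda>s. u s j)"
  using assms unfolding B_set_def X_space_def by (intro bounded_measurable_on_continuous) auto

lemma admissible_boundary_inflow:
  assumes u: "u \<in> B_set T n" and r: "r \<in> {1, 2, 3}" and j: "j \<in> {1..n}"
  shows "Adm (\<lambda>s x. \<Phi> (density n (u s)) (density n (road r x)) * u s j)"
proof (intro admissible_mult admissible_limiter admissible_density r)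
  show "Adm (\<lambda>s x. u s j)"
    by (intro admissible_time bounded_measurable_B_set u j)
  show "Adm (\<lambda>s x. density n (u s))"
    unfolding density_def
    by (intro admissible_time bounded_measurable_on_sum bounded_measurable_B_set u)
qed (use B_set_density[OF u] states_density[OF _ r] in auto)

lemma admissible_inflow: "Adm (\<lambda>s x. inflow s x (r, j))" if "r \<in> {1, 2, 3}" "j \<in> {1..n}"
proof -
  have "Adm (\<lambda>s x. limiter_value x * (road 1 x j + acc x * road 2 x j) * delta_c j)"
    by (intro admissible_mult admissible_add admissible_limiter_value admissible_acc admissible_road
        admissible_const that(2)) auto
  then show ?thesis
    using admissible_boundary_inflow[OF fb1, of 1 j] admissible_boundary_inflow[OF fb2, of 2 j] that
    by (auto simp: inflow_def)
qed

text \<open>The limiter \<open>Pb3\<close> is a pure function of time, with Lipschitz constant 0 in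
  the state, so its measurability and its range suffice.\<close>

lemma admissible_outflow: "Adm (\<lambda>s x. outflow s x r)"
proof -
  have "bounded_measurable_on T Pb3"
    unfolding bounded_measurable_on_def
    using Pb3_measurable Pb3_range by (auto intro!: exI[of _ 1])
  then show ?thesis
    unfolding outflow_def
    by (cases "r = 1"; cases "r = 2")
      (auto intro: admissible_time admissible_mult admissible_acc admissible_limiter_value)
qed

lemma admissible_gain: "Adm (\<lambda>s x. gain \<eta>0 n A (road r x) j)"
  if r: "r \<in> {1, 2, 3}" and j: "j \<in> {1..n}"
  unfolding gain_def
proof (intro admissible_mult admissible_sum admissible_road admissible_density admissible_const r)
  fix h k assume h: "h \<in> {1..n}" and k: "k \<in> {1..n}"
  obtain C where C: "C-lipschitz_on {0..1} (A h k j)"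
    using games h k j unfolding table_of_games_def by blast
  show "Adm (\<lambda>s x. A h k j (density n (road r x)))"
    using table_of_games_le_1[OF games h k j]
    by (intro admissible_compose[OF admissible_density[OF r] states_density[OF _ r] _ C, where B = 1])
      auto
qed

lemma admissible_field:
  assumes "i \<in> junction_index n"
  shows "Adm (\<lambda>s x. field s x i)"
proof -
  obtain r j where i: "i = (r, j)" and r: "r \<in> {1, 2, 3}" and j: "j \<in> {1..n}"
    using assms unfolding junction_index_def by auto
  show ?thesis
    unfolding field_def i prod.case loss_def power2_eq_square
    by (intro admissible_diff admissible_add admissible_mult admissible_const admissible_gain
        admissible_inflow admissible_outflow admissible_road admissible_density r j)
qed

section \<open>Return from the stacked state to the three roads\<close>

lemma curves_road_B_set:
  assumes "y \<in> curves T (junction_index n) states" "r \<in> {1, 2, 3}"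
  shows "(\<lambda>t. road r (y t)) \<in> B_set T n"
proof -
  have "continuous_on {0..T} (\<lambda>t. road r (y t) j)" if "j \<in> {1..n}" for j
    using curves_continuous[OF assms(1), of "(r, j)"] assms(2) that
    by (simp add: road_def junction_index_def)
  moreover have "0 \<le> road r (y t) j \<and> road r (y t) j \<le> 1" "density n (road r (y t)) \<le> 1"
    if "t \<in> {0..T}" "j \<in> {1..n}" for t j
    using states_nonneg states_le_1 states_density curves_mem[OF assms(1)] assms(2) that by auto
  \<comment> \<open>The density bound was stated for some index \<open>j\<close>; the assumption on
    \<open>n\<close> provides one.\<close>
  ultimately show ?thesis
    using n_ge_2 unfolding B_set_def X_space_def by fastforce
qed

lemma mild_solution:
  assumes \<phi>: "(\<lambda>t. \<phi>1) \<in> B_set T n" "(\<lambda>t. \<phi>2) \<in> B_set T n" "(\<lambda>t. \<phi>3) \<in> B_set T n"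
  shows "\<exists>F \<in> B_set T n \<times> B_set T n \<times> B_set T n.
    mild_kinetic_solution_21 T n v p \<eta>0 H A \<Phi> \<phi>1 \<phi>2 \<phi>3 fb1 fb2 Pb3 F"
proof -
  define \<phi> where "\<phi> = (\<lambda>(r::nat, j). if r = 1 then \<phi>1 j else if r = 2 then \<phi>2 j else \<phi>3 j)"
  have "0 \<in> {0..T}" using T_pos by simp
  note init = B_set_nonneg[OF _ this] B_set_density[OF _ this]
  interpret subtangential_field T "junction_index n" "junction_constraints n" field \<phi> "1 / (1 + \<eta>0)"
  proof
    show "\<phi> \<in> states"
      unfolding junction_states_iff
      using init[OF \<phi>(1)] init[OF \<phi>(2)] init[OF \<phi>(3)] by (auto simp: \<phi>_def road_def)
  qed (use T_pos eta finite_junction_index admissible_field field_subtangential in auto)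
  obtain y where y: "y \<in> curves T (junction_index n) states"
    "\<And>t i. t \<in> {0..T} \<Longrightarrow> i \<in> junction_index n \<Longrightarrow>
       y t i = \<phi> i + integral {0..t} (\<lambda>s. field s (y s) i)"
    using viable_solution by blast
  have eq: "integral_equation T n (\<lambda>j. \<phi> (r, j)) (\<lambda>s j. field s (y s) (r, j)) (\<lambda>t. road r (y t))"
    if "r \<in> {1, 2, 3}" for r
    unfolding integral_equation_def
  proof (intro ballI conjI)
    fix t j assume t: "t \<in> {0..T}" and j: "j \<in> {1..n}"
    have i: "(r, j) \<in> junction_index n"
      using that j by (simp add: junction_index_def)
    show "(\<lambda>s. field s (y s) (r, j)) absolutely_integrable_on {0..t}"
      using t admissible_along_curve[OF admissible_field[OF i] y(1)]
      by (intro bounded_measurable_on_absolutely_integrable) auto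
    show "road r (y t) j = \<phi> (r, j) + integral {0..t} (\<lambda>s. field s (y s) (r, j))"
      using y(2)[OF t i] by (simp add: road_def)
  qed
  let ?F = "(\<lambda>t. road 1 (y t), \<lambda>t. road 2 (y t), \<lambda>t. road 3 (y t))"
  have "?F \<in> B_set T n \<times> B_set T n \<times> B_set T n"
    using curves_road_B_set[OF y(1)] by simp
  moreover from this have "mild_kinetic_solution_21 T n v p \<eta>0 H A \<Phi> \<phi>1 \<phi>2 \<phi>3 fb1 fb2 Pb3 ?F"
    using eq[of 1] eq[of 2] eq[of 3]
    unfolding mild_kinetic_solution_21_def
    by (simp add: field_def inflow_def outflow_def \<phi>_def limiter_value_def acc_def)
  ultimately show ?thesis by blast
qed

end

theorem theorem4p9:
  fixes T p \<eta>0 \<epsilon> :: real and n :: nat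
    and v :: "nat \<Rightarrow> real" and H :: "real \<Rightarrow> real"
    and A :: "nat \<Rightarrow> nat \<Rightarrow> nat \<Rightarrow> real \<Rightarrow> real"
    and \<Phi> :: "real \<Rightarrow> real \<Rightarrow> real"
    and \<phi>1 \<phi>2 \<phi>3 :: "nat \<Rightarrow> real"
    and fb1 fb2 :: "real \<Rightarrow> nat \<Rightarrow> real"
    and Pb3 :: "real \<Rightarrow> real"
  assumes "T > 0" and "n \<ge> 2" and "speeds n v"
    and "0 \<le> p" and "p \<le> 1" and "p \<le> v 2"
    and "\<eta>0 > 0"
    and "\<epsilon> > 0" and "regularized_heaviside \<epsilon> H"
    and "table_of_games n A"
    and "flux_limiter \<Phi>"
    and "(\<lambda>t. \<phi>1) \<in> B_set T n" and "(\<lambda>t. \<phi>2) \<in> B_set T n" and "(\<lambda>t. \<phi>3) \<in> B_set T n"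
    and "fb1 \<in> B_set T n" and "fb2 \<in> B_set T n"
    and "Pb3 \<in> borel_measurable (lebesgue_on {0..T})"
    and "\<And>t. t \<in> {0..T} \<Longrightarrow> 0 \<le> Pb3 t \<and> Pb3 t \<le> 1"
  shows "\<exists>F \<in> B_set T n \<times> B_set T n \<times> B_set T n.
           mild_kinetic_solution_21 T n v p \<eta>0 H A \<Phi> \<phi>1 \<phi>2 \<phi>3 fb1 fb2 Pb3 F"
proof -
  interpret junction_21 T p \<eta>0 \<epsilon> n v H A \<Phi> fb1 fb2 Pb3
    by unfold_locales (use assms in auto)
  show ?thesis
    by (rule mild_solution) fact+
qed

end
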